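(* One has $\Gamma_1=1$, and for every integer $n\geqslant 2$, $$2n-1\leqslant \Gamma_n<\infty .$$ In particular, for every $n\geqslant1$ there is a finite constant $C$ depending only on $n$ such that $\|p(a)\|\leqslant C\sup_{z\in V(a,\mathcal A)}|p(z)|$ for every unital Banach algebra $\mathcal A$, every $a\in\mathcal A$ of algebraic degree at most $n$ and every polynomial $p\in\mathbb C[z]$; and for every $d\geqslant1$ there is a finite constant $C$ depending only on $d$ such that the same inequality holds for all $a\in\mathcal A$ and $p\in\mathbb C[z]$ whenever $\mathcal A$ is the matrix algebra $M_d(\mathbb C)$ equipped with an arbitrary unital submultiplicative norm (i.e. a submultiplicative norm with $\|I\|=1$).
   Context: All Banach algebras are complex and unital, and the unit has norm one. For $a$ in a unital Banach algebra $\mathcal A$, the algebraic numerical range is $V(a,\mathcal A)=\{\varphi(a):\varphi\in\mathcal A',\ \|\varphi\|=1=\varphi(1)\}$, where $\mathcal A'$ is the dual space. The spectral constant of $a$ is $$\Psi(a,\mathcal A)=\sup\left\{\frac{\|p(a)\|}{\sup_{z\in V(a,\mathcal A)}|p(z)|}:\ p\in\mathbb C[z],\ \sup_{z\in V(a,\mathcal A)}|p(z)|>0\right\}\in[1,\infty].$$ An element is algebraic if it satisfies a non-zero polynomial; its algebraic degree is the degree of its minimal polynomial. For $n\geqslant1$, $$\Gamma_n=\sup\{\Psi(a,\mathcal A):\ \mathcal A\text{ a unital Banach algebra},\ a\in\mathcal A\text{ of algebraic degree at most }n\}.$$ *)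

theory Defs
  imports
    "HOL-Analysis.Analysis"
    "HOL-Computational_Algebra.Polynomial"
    "Jordan_Normal_Form.Matrix"
begin

section \<open>Unital Banach algebras\<close>

text \<open>
  Algebras are HOL-Algebra structures with an explicit carrier, so that one can quantify over
  algebras inside a formula, and so that several norms on the same matrix algebra can be compared.
  The locale \<^locale>\<open>algebra\<close> of HOL-Algebra is not used because it is restricted to commutative
  algebras.
\<close>

definition complex_ring :: "complex ring" where
  "complex_ring = \<lparr>carrier = UNIV, mult = (*), one = 1, zero = 0, add = (+)\<rparr>"

record 'a normed_alg = "(complex, 'a) module" +
  anorm :: "'a \<Rightarrow> real"

locale unital_normed_algebra = ring A + module complex_ring A for A (structure) +
  assumes smult_mult_left:
      "\<lbrakk>x \<in> carrier A; y \<in> carrier A\<rbrakk> \<Longrightarrow> (c \<odot> x) \<otimes> y = c \<odot> (x \<otimes> y)"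
    and smult_mult_right:
      "\<lbrakk>x \<in> carrier A; y \<in> carrier A\<rbrakk> \<Longrightarrow> x \<otimes> (c \<odot> y) = c \<odot> (x \<otimes> y)"
    and anorm_nonneg: "x \<in> carrier A \<Longrightarrow> 0 \<le> anorm A x"
    and anorm_eq_0: "x \<in> carrier A \<Longrightarrow> anorm A x = 0 \<longleftrightarrow> x = \<zero>"
    and anorm_smult: "x \<in> carrier A \<Longrightarrow> anorm A (c \<odot> x) = cmod c * anorm A x"
    and anorm_add: "\<lbrakk>x \<in> carrier A; y \<in> carrier A\<rbrakk> \<Longrightarrow> anorm A (x \<oplus> y) \<le> anorm A x + anorm A y"
    and anorm_mult: "\<lbrakk>x \<in> carrier A; y \<in> carrier A\<rbrakk> \<Longrightarrow> anorm A (x \<otimes> y) \<le> anorm A x * anorm A y"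
    and anorm_one: "anorm A \<one> = 1"

text \<open>
  The value 0 off the carrier is immaterial; it is there because \<^locale>\<open>Metric_space\<close> demands
  symmetry and nonnegativity of the distance function on the whole type.
\<close>

definition adist :: "('a, 'm) normed_alg_scheme \<Rightarrow> 'a \<Rightarrow> 'a \<Rightarrow> real" where
  "adist A x y = (if x \<in> carrier A \<and> y \<in> carrier A then anorm A (x \<ominus>\<^bsub>A\<^esub> y) else 0)"

locale unital_banach_algebra = unital_normed_algebra +
  assumes complete: "Metric_space.mcomplete (carrier A) (adist A)"

section \<open>Numerical range and spectral constant\<close>

text \<open>Functionals are total functions on the type; only their values on the carrier matter.\<close>

definition dual_space :: "('a, 'm) normed_alg_scheme \<Rightarrow> ('a \<Rightarrow> complex) set" where
  "dual_space A = {\<phi>.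
     (\<forall>x\<in>carrier A. \<forall>y\<in>carrier A. \<phi> (x \<oplus>\<^bsub>A\<^esub> y) = \<phi> x + \<phi> y) \<and>
     (\<forall>c. \<forall>x\<in>carrier A. \<phi> (c \<odot>\<^bsub>A\<^esub> x) = c * \<phi> x) \<and>
     (\<exists>B. \<forall>x\<in>carrier A. cmod (\<phi> x) \<le> B * anorm A x)}"

definition dual_norm :: "('a, 'm) normed_alg_scheme \<Rightarrow> ('a \<Rightarrow> complex) \<Rightarrow> real" where
  "dual_norm A \<phi> = (SUP x\<in>{x \<in> carrier A. anorm A x \<le> 1}. cmod (\<phi> x))"

definition numerical_range :: "('a, 'm) normed_alg_scheme \<Rightarrow> 'a \<Rightarrow> complex set" where
  "numerical_range A a = {\<phi> a |\<phi>. \<phi> \<in> dual_space A \<and> dual_norm A \<phi> = 1 \<and> \<phi> \<one>\<^bsub>A\<^esub> = 1}"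

definition poly_eval :: "('a, 'm) normed_alg_scheme \<Rightarrow> complex poly \<Rightarrow> 'a \<Rightarrow> 'a" where
  "poly_eval A p a = (\<Oplus>\<^bsub>A\<^esub>i\<in>{..degree p}. coeff p i \<odot>\<^bsub>A\<^esub> (a [^]\<^bsub>A\<^esub> i))"

text \<open>The numerical range is nonempty and bounded, so the real supremum is the genuine one.\<close>

definition range_sup :: "('a, 'm) normed_alg_scheme \<Rightarrow> 'a \<Rightarrow> complex poly \<Rightarrow> real" where
  "range_sup A a p = (SUP z\<in>numerical_range A a. cmod (poly p z))"

definition spectral_constant :: "('a, 'm) normed_alg_scheme \<Rightarrow> 'a \<Rightarrow> ereal" where
  "spectral_constant A a =
     (SUP p\<in>{p. range_sup A a p > 0}. ereal (anorm A (poly_eval A p a) / range_sup A a p))"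

section \<open>Algebraic degree and the universal constants\<close>

definition algebraic_elem :: "('a, 'm) normed_alg_scheme \<Rightarrow> 'a \<Rightarrow> bool" where
  "algebraic_elem A a \<longleftrightarrow> (\<exists>p. p \<noteq> 0 \<and> poly_eval A p a = \<zero>\<^bsub>A\<^esub>)"

definition minimal_poly :: "('a, 'm) normed_alg_scheme \<Rightarrow> 'a \<Rightarrow> complex poly" where
  "minimal_poly A a =
     (THE m. lead_coeff m = 1 \<and> (\<forall>p. poly_eval A p a = \<zero>\<^bsub>A\<^esub> \<longleftrightarrow> m dvd p))"

definition algebraic_degree :: "('a, 'm) normed_alg_scheme \<Rightarrow> 'a \<Rightarrow> nat" where
  "algebraic_degree A a = degree (minimal_poly A a)"

definition algebraic_degree_le :: "('a, 'm) normed_alg_scheme \<Rightarrow> 'a \<Rightarrow> nat \<Rightarrow> bool" where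
  "algebraic_degree_le A a n \<longleftrightarrow> algebraic_elem A a \<and> algebraic_degree A a \<le> n"

text \<open>
  A formula of HOL cannot quantify over types, so the supremum over all unital Banach algebras is
  first taken over those with carrier in a given type \<open>'u\<close>. The type is then fixed to
  \<open>nat \<Rightarrow> complex\<close>, which is large enough: an algebraic element lies in the finite-dimensional
  closed subalgebra that it generates, every finite-dimensional algebra has a copy inside this
  type, and the passage to the subalgebra does not change the numerical range. That no type gives
  a larger supremum is part of the theorem and is not built into the definition.
\<close>

definition Gamma_in :: "'u itself \<Rightarrow> nat \<Rightarrow> ereal" where
  "Gamma_in _ n =
     (SUP (A, a)\<in>{(A :: 'u normed_alg, a). unital_banach_algebra A \<and> a \<in> carrier A \<and>
        algebraic_degree_le A a n}. spectral_constant A a)"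

definition Gamma_const :: "nat \<Rightarrow> ereal" where
  "Gamma_const n = Gamma_in TYPE(nat \<Rightarrow> complex) n"

section \<open>Normed matrix algebras\<close>

definition matrix_alg :: "nat \<Rightarrow> (complex mat \<Rightarrow> real) \<Rightarrow> complex mat normed_alg" where
  "matrix_alg d N = \<lparr>carrier = carrier_mat d d, mult = (*), one = 1\<^sub>m d, zero = 0\<^sub>m d d,
     add = (+), smult = (\<cdot>\<^sub>m), anorm = N\<rparr>"

lemma cring_complex_ring: "cring complex_ring"
proof -
  have "\<exists>y. y + x = 0" for x :: complex
    by (rule exI[of _ "-x"]) simp
  moreover have "\<exists>y. x + y = 0" for x :: complex
    by (rule exI[of _ "-x"]) simp
  ultimately show ?thesis
    by (unfold_locales) (auto simp: complex_ring_def algebra_simps Units_def)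
qed

text \<open>
  The algebra axioms hold automatically for matrices: what remains is exactly that \<open>N\<close> is a
  submultiplicative norm on the matrices of size \<open>d\<close> with value 1 at the identity.
\<close>

lemma unital_normed_algebra_matrix_alg_iff:
  "unital_normed_algebra (matrix_alg d N) \<longleftrightarrow>
     (\<forall>X\<in>carrier_mat d d. 0 \<le> N X) \<and>
     (\<forall>X\<in>carrier_mat d d. N X = 0 \<longleftrightarrow> X = 0\<^sub>m d d) \<and>
     (\<forall>c. \<forall>X\<in>carrier_mat d d. N (c \<cdot>\<^sub>m X) = cmod c * N X) \<and>
     (\<forall>X\<in>carrier_mat d d. \<forall>Y\<in>carrier_mat d d. N (X + Y) \<le> N X + N Y) \<and>
     (\<forall>X\<in>carrier_mat d d. \<forall>Y\<in>carrier_mat d d. N (X * Y) \<le> N X * N Y) \<and>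
     N (1\<^sub>m d) = 1"  (is "?L \<longleftrightarrow> ?R")
proof
  assume ?L
  then interpret unital_normed_algebra "matrix_alg d N" .
  show ?R
    using anorm_nonneg anorm_eq_0 anorm_smult anorm_add anorm_mult anorm_one
    by (simp add: matrix_alg_def)
next
  assume R: ?R
  have "ring (ring_mat TYPE(complex) d (ring.more (matrix_alg d N)))"
    by (rule ring_mat)
  then have ri: "ring (matrix_alg d N)"
    by (simp add: matrix_alg_def ring_mat_def)
  have ag: "abelian_group (matrix_alg d N)"
    by (rule ring.is_abelian_group[OF ri])
  have sm: "(c * e) \<cdot>\<^sub>m X = c \<cdot>\<^sub>m (e \<cdot>\<^sub>m X)" for c e :: complex and X
    by (rule eq_matI) auto
  have mo2: "module complex_ring (matrix_alg d N)"
    by (rule moduleI[OF cring_complex_ring ag])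
      (auto simp: complex_ring_def matrix_alg_def add_smult_distrib_right_mat
        add_smult_distrib_left_mat sm)
  show ?L
    by (rule unital_normed_algebra.intro[OF ri mo2], unfold_locales)
      (use R in \<open>auto simp: matrix_alg_def mult_smult_assoc_mat mult_smult_distrib\<close>)
qed

end

theory Submission
  imports
    Defs
    "HOL-Complex_Analysis.Conformal_Mappings"
    "HOL-Computational_Algebra.Fundamental_Theorem_Algebra"
begin

text \<open>
  By the Hahn-Banach theorem, \<open>\<parallel>(z - a) y\<parallel> \<ge> dist (z, V(a)) \<parallel>y\<parallel>\<close>. The upper bound uses nothing else: it
  is a statement about seminorms \<open>S\<close> on the polynomials (here \<open>S p = \<parallel>p(a)\<parallel>\<close>) that satisfy
  \<open>S ((z - X) p) \<ge> dist (z, K) S p\<close> for a compact convex set \<open>K\<close> and vanish on the multiples of a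
  polynomial of degree \<open>n\<close>. This class is stable under \<open>S \<mapsto> S ((X - l) \<cdot>)\<close>, which lowers \<open>n\<close> by one if
  \<open>l\<close> is a root of that polynomial, so one can induct on \<open>n\<close>. If all roots and a boundary point of
  \<open>K\<close> lie within \<open>D\<close> of each other, then \<open>X - l\<close> has norm at most \<open>c\<^sub>n D\<close>.

  For the lower bound, take the largest norm on \<open>\<complex>[X] / \<Prod>(X - \<mu>\<^sub>j)\<close> with \<open>\<parallel>X\<parallel> \<le> 1\<close>, where
  \<open>0 \<le> \<mu>\<^sub>0 < \<dots> < \<mu>\<^sub>k \<le> 1\<close> and \<open>n = k + 1\<close>. The functional
  \<open>p(\<mu>\<^sub>0) + \<Sum> (-1)\<^sup>j (p(\<mu>\<^sub>j) - p(\<mu>\<^sub>j\<^sub>-\<^sub>1))\<close> is bounded by 1 on all powers of \<open>X\<close>, and its value at a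
  polynomial that is bounded by 1 on the unit disc and close to \<open>(-1)\<^sup>j\<close> at \<open>\<mu>\<^sub>j\<close> is close to
  \<open>2 n - 1\<close>.
\<close>

section \<open>Seminorms on polynomials with a resolvent estimate\<close>

context
  notes mult_pCons_left [simp del] mult_pCons_right [simp del]
begin

text \<open>The obstacle is uniformity in the position of the roots: interpolation at the roots has
  constants that blow up when roots collide, and roots deep inside \<open>K\<close> behave
  differently from roots near its boundary. The proof compares two lengths, the distance of one root
  from the complement of \<open>K\<close> and the spread of all roots. Whichever dominates, a
  division by that length is repaid by a linear factor \<open>X - l\<close> whose size is
  proportional to the same length. Seminorms replace algebra norms because
  \<open>S ((X - l) p)\<close>, as a function of \<open>p\<close>, is in general neither
  submultiplicative nor normalised; so all bounds are relative to \<open>S 1\<close>.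

  In the lower bound the norm is a supremum over functionals, so that one explicit functional bounds
  it from below, while the numerical range stays in the unit disc because \<open>X\<close> has norm
  at most 1.

  An algebra over an arbitrary type reaches the fixed type through the polynomials modulo the
  minimal polynomial. By Hahn-Banach extension the numerical range can only shrink there, so the
  ratios that define the spectral constant can only grow.\<close>

definition poly_seminorm :: "(complex poly \<Rightarrow> real) \<Rightarrow> bool" where
  "poly_seminorm S \<longleftrightarrow>
     (\<forall>p q. S (p + q) \<le> S p + S q) \<and> (\<forall>c p. S (Polynomial.smult c p) = cmod c * S p)"

text \<open>The number \<open>d\<close> runs over all lower bounds of the distance from
  \<open>z\<close> to \<open>K\<close>, and \<open>[:z, -1:]\<close> is
  \<open>z - X\<close>.\<close>

definition resolvent_bounded :: "complex set \<Rightarrow> (complex poly \<Rightarrow> real) \<Rightarrow> bool" where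
  "resolvent_bounded K S \<longleftrightarrow>
     (\<forall>z d p. (\<forall>w\<in>K. d \<le> cmod (z - w)) \<longrightarrow> d * S p \<le> S ([:z, -1:] * p))"

definition root_poly :: "complex multiset \<Rightarrow> complex poly" where
  "root_poly L = (\<Prod>x\<in>#L. [:- x, 1:])"

definition annihilates :: "complex multiset \<Rightarrow> (complex poly \<Rightarrow> real) \<Rightarrow> bool" where
  "annihilates L S \<longleftrightarrow> (\<forall>q. S (root_poly L * q) = 0)"

definition shift_seminorm :: "complex \<Rightarrow> (complex poly \<Rightarrow> real) \<Rightarrow> complex poly \<Rightarrow> real" where
  "shift_seminorm l S p = S ([:- l, 1:] * p)"

lemma root_poly_simps [simp]:
  "root_poly {#} = 1" "root_poly (add_mset l L) = [:- l, 1:] * root_poly L"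
  by (simp_all add: root_poly_def)

lemma poly_seminorm_add: "poly_seminorm S \<Longrightarrow> S (p + q) \<le> S p + S q"
  and poly_seminorm_smult: "poly_seminorm S \<Longrightarrow> S (Polynomial.smult c p) = cmod c * S p"
  by (simp_all add: poly_seminorm_def)

lemma poly_seminorm_0: "poly_seminorm S \<Longrightarrow> S 0 = 0"
  using poly_seminorm_smult[of S 0 0] by simp

lemma poly_seminorm_minus: "poly_seminorm S \<Longrightarrow> S (- p) = S p"
  using poly_seminorm_smult[of S "-1" p] by simp

lemma poly_seminorm_diff: "poly_seminorm S \<Longrightarrow> S (p - q) \<le> S p + S q"
  using poly_seminorm_add[of S p "- q"] by (simp add: poly_seminorm_minus)

lemma poly_seminorm_nonneg: "poly_seminorm S \<Longrightarrow> 0 \<le> S p"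
  using poly_seminorm_diff[of S p p] by (simp add: poly_seminorm_0)

lemma poly_seminorm_eq_mod:
  assumes "poly_seminorm S" "S (p - q) = 0"
  shows "S p = S q"
  using poly_seminorm_add[OF assms(1), of "p - q" q] poly_seminorm_diff[OF assms(1), of p "p - q"]
    assms(2) by simp

lemma poly_seminorm_shift:
  assumes "poly_seminorm S"
  shows "poly_seminorm (shift_seminorm l S)"
  using assms by (simp add: poly_seminorm_def shift_seminorm_def distrib_left)

lemma resolvent_bounded_shift:
  assumes "resolvent_bounded K S"
  shows "resolvent_bounded K (shift_seminorm l S)"
  unfolding resolvent_bounded_def shift_seminorm_def
proof (intro allI impI)
  fix z d p
  assume "\<forall>w\<in>K. d \<le> cmod (z - w)"
  then have "d * S ([:- l, 1:] * p) \<le> S ([:z, -1:] * ([:- l, 1:] * p))"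
    using assms unfolding resolvent_bounded_def by blast
  also have "[:z, -1:] * ([:- l, 1:] * p) = [:- l, 1:] * ([:z, -1:] * p)"
    by (rule mult.left_commute)
  finally show "d * S ([:- l, 1:] * p) \<le> S ([:- l, 1:] * ([:z, -1:] * p))" .
qed

lemma annihilates_shift:
  assumes "annihilates (add_mset l L) S"
  shows "annihilates L (shift_seminorm l S)"
  using assms by (simp add: annihilates_def shift_seminorm_def mult.assoc)

section \<open>Size of linear factors near the boundary of the convex set\<close>

lemma shift_change:
  assumes S: "poly_seminorm S"
  shows "S ([:- l, 1:] * p) \<le> S ([:- b, 1:] * p) + cmod (l - b) * S p"
proof -
  have "[:- l, 1:] * p = [:- b, 1:] * p - Polynomial.smult (l - b) p"
    by (simp add: mult_pCons_left smult_diff_left)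
  then show ?thesis
    using poly_seminorm_diff[OF S, of "[:- b, 1:] * p" "Polynomial.smult (l - b) p"]
      poly_seminorm_smult[OF S] by simp
qed

text \<open>With \<open>C\<close> the previous constant and \<open>t = C + 2\<close>, the proof
  below produces \<open>(t + 1) (2 t + 1)\<close> for the factor \<open>X - l\<close>; the last
  summand pays for moving the centre from \<open>l\<close> back to \<open>b\<close>.\<close>

primrec half_plane_const :: "nat \<Rightarrow> real" where
  "half_plane_const 0 = 0"
| "half_plane_const (Suc n) = (half_plane_const n + 3) * (2 * half_plane_const n + 5) + 1"

lemma half_plane_const_nonneg: "0 \<le> half_plane_const n"
  by (induction n) auto

text \<open>Write \<open>Y = X - l\<close>. By induction \<open>S (Y\<^sup>2 p)\<close> is controlled by \<open>S (Y p)\<close>, and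
  \<open>(\<zeta> - Y) (\<zeta> + Y) = \<zeta>\<^sup>2 - Y\<^sup>2\<close> turns the lower bound for \<open>\<zeta> - Y\<close> into an upper bound for \<open>Y\<close>.\<close>

lemma half_plane_bound:
  assumes "poly_seminorm S" "resolvent_bounded K S" "annihilates L S" "size L = n"
    and u: "cmod u = 1" and H: "\<forall>z\<in>K. inner u (z - b) \<le> 0" and d: "\<delta> > 0"
    and "\<forall>l\<in>#L. cmod (l - b) \<le> \<delta>"
  shows "S ([:- b, 1:] * p) \<le> half_plane_const n * \<delta> * S p"
  using assms(1-4,8)
proof (induction n arbitrary: S L)
  case 0
  then show ?case by (auto simp: annihilates_def)
next
  case (Suc n)
  note S = Suc.prems(1) and R = Suc.prems(2) and A = Suc.prems(3) and L = Suc.prems(4)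
    and near = Suc.prems(5)
  define C where "C = half_plane_const n"
  have C: "C \<ge> 0" by (simp add: C_def half_plane_const_nonneg)
  \<comment> \<open>This exceeds by one the factor \<open>C + 1\<close> in \<open>Y2\<close> below.
    When the terms in \<open>S (Y * p)\<close> are collected, exactly one
    \<open>\<delta> * S (Y * p)\<close> survives on the left.\<close>
  define t where "t = C + 2"
  obtain l L' where l: "L = add_mset l L'"
    using L by (meson size_eq_Suc_imp_eq_union)
  define Y where "Y = [:- l, 1:]"
  have lb: "cmod (l - b) \<le> \<delta>"
    using near l by simp
  have "S ([:- l, 1:] * ([:- b, 1:] * p)) \<le> C * \<delta> * S ([:- l, 1:] * p)"
    using Suc.IH[OF poly_seminorm_shift[OF S] resolvent_bounded_shift[OF R]
        annihilates_shift[OF A[unfolded l]]] near L l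
    by (simp add: shift_seminorm_def C_def)
  moreover have "S (Y * (Y * p)) \<le> S ([:- b, 1:] * (Y * p)) + cmod (l - b) * S (Y * p)"
    unfolding Y_def by (rule shift_change[OF S])
  moreover have "cmod (l - b) * S (Y * p) \<le> \<delta> * S (Y * p)"
    by (intro mult_right_mono lb poly_seminorm_nonneg S)
  \<comment> \<open>\<open>C\<close> comes from the induction hypothesis for the shifted seminorm,
    centred at \<open>b\<close>; the extra 1 recentres from \<open>b\<close> to
    \<open>l\<close>.\<close>
  ultimately have Y2: "S (Y * (Y * p)) \<le> (C + 1) * \<delta> * S (Y * p)"
    by (simp add: Y_def mult.left_commute[of "[:- b, 1:]"] algebra_simps)
  \<comment> \<open>Moving from \<open>b\<close> by \<open>\<delta> t\<close> along the outer normal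
    \<open>u\<close> keeps \<open>z\<close> at least that far from the half-plane that contains
    \<open>K\<close>.\<close>
  define z where "z = b + of_real (\<delta> * t) * u"
  define \<zeta> where "\<zeta> = z - l"
  have t: "t \<ge> 2" using C by (simp add: t_def)
  have "cmod (z - b) = \<delta> * t"
    using u d t by (simp add: z_def norm_mult)
  then have zeta: "cmod \<zeta> \<le> (t + 1) * \<delta>"
    using lb norm_triangle_ineq4[of "z - b" "l - b"] by (simp add: \<zeta>_def algebra_simps)
  have far: "\<forall>w\<in>K. \<delta> * t \<le> cmod (z - w)"
  proof
    fix w assume w: "w \<in> K"
    have "inner u (z - w) = \<delta> * t * (inner u u) - inner u (w - b)"
      by (simp add: z_def inner_diff_right inner_add_right flip: scaleR_conv_of_real)
    also have "inner u u = 1"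
      using u by (simp add: power2_norm_eq_inner[symmetric])
    finally have "\<delta> * t \<le> inner u (z - w)"
      using H w by simp
    also have "\<dots> \<le> cmod u * cmod (z - w)"
      by (rule norm_cauchy_schwarz)
    finally show "\<delta> * t \<le> cmod (z - w)"
      using u by simp
  qed
  \<comment> \<open>This is \<open>(\<zeta> + Y) p\<close>, and \<open>z - X = \<zeta> - Y\<close>
    since \<open>\<zeta> = z - l\<close>.\<close>
  define g where "g = Polynomial.smult \<zeta> p + Y * p"
  have "[:z, -1:] = [:\<zeta>:] - Y"
    by (simp add: \<zeta>_def Y_def)
  moreover have sm: "Polynomial.smult c q = [:c:] * q" for c q
    by (simp add: mult_pCons_left)
  moreover have "([:\<zeta>:] - Y) * ([:\<zeta>:] * p + Y * p) = [:\<zeta>:] * [:\<zeta>:] * p - Y * (Y * p)"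
    by (simp add: algebra_simps)
  moreover have "[:\<zeta>:] * [:\<zeta>:] = [:\<zeta>\<^sup>2:]"
    by (simp add: mult_pCons_left power2_eq_square)
  ultimately have "[:z, -1:] * g = Polynomial.smult (\<zeta>\<^sup>2) p - Y * (Y * p)"
    unfolding g_def by metis
  then have "\<delta> * t * S g \<le> S (Polynomial.smult (\<zeta>\<^sup>2) p - Y * (Y * p))"
    using R far unfolding resolvent_bounded_def by metis
  also have "\<dots> \<le> (cmod \<zeta>)\<^sup>2 * S p + S (Y * (Y * p))"
    using poly_seminorm_diff[OF S] poly_seminorm_smult[OF S] by (metis norm_power)
  also have "\<dots> \<le> ((t + 1) * \<delta>)\<^sup>2 * S p + (C + 1) * \<delta> * S (Y * p)"
    by (intro add_mono mult_right_mono power_mono zeta Y2 poly_seminorm_nonneg[OF S]) auto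
  finally have g: "\<delta> * t * S g \<le> ((t + 1) * \<delta>)\<^sup>2 * S p + (t - 1) * \<delta> * S (Y * p)"
    by (simp add: t_def add.commute)
  have "Y * p = g - Polynomial.smult \<zeta> p"
    by (simp add: g_def)
  then have "S (Y * p) \<le> S g + cmod \<zeta> * S p"
    using poly_seminorm_diff[OF S] poly_seminorm_smult[OF S] by metis
  also have "\<dots> \<le> S g + (t + 1) * \<delta> * S p"
    by (intro add_left_mono mult_right_mono zeta poly_seminorm_nonneg S)
  finally have "\<delta> * t * S (Y * p) \<le> \<delta> * t * (S g + (t + 1) * \<delta> * S p)"
    using d t by (intro mult_left_mono) auto
  \<comment> \<open>The coefficient of \<open>\<delta>^2 S p\<close> is
    \<open>(t + 1)^2 + t (t + 1) = (t + 1) (2 t + 1)\<close>.\<close>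
  with g have "\<delta> * S (Y * p) \<le> \<delta> * ((t + 1) * (2 * t + 1) * \<delta> * S p)"
    by (simp add: algebra_simps power2_eq_square)
  then have "S (Y * p) \<le> (t + 1) * (2 * t + 1) * \<delta> * S p"
    using d by simp
  moreover have "S ([:- b, 1:] * p) \<le> S (Y * p) + cmod (b - l) * S p"
    unfolding Y_def by (rule shift_change[OF S])
  moreover have "cmod (b - l) * S p \<le> \<delta> * S p"
    using lb by (intro mult_right_mono poly_seminorm_nonneg S) (simp add: norm_minus_commute)
  ultimately have "S ([:- b, 1:] * p) \<le> ((t + 1) * (2 * t + 1) + 1) * \<delta> * S p"
    by (simp add: algebra_simps)
  then show ?case
    by (simp add: t_def C_def add.commute)
qed

text \<open>All roots lie within \<open>3 D\<close> of a boundary point \<open>b\<close>; the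
  half-plane estimate at \<open>b\<close> costs the first summand and the return from
  \<open>b\<close> to the root the second.\<close>

definition root_spread_const :: "nat \<Rightarrow> real" where
  "root_spread_const n = 3 * half_plane_const n + 3"

lemma root_spread_const_nonneg: "0 \<le> root_spread_const n"
  using half_plane_const_nonneg[of n] by (simp add: root_spread_const_def)

text \<open>The point of \<open>K\<close> closest to \<open>x\<close> is a boundary point
  \<open>b\<close> with a supporting half-plane, and it lies within \<open>2 D\<close> of
  \<open>a\<close>. So the half-plane estimate applies at \<open>b\<close> with radius
  \<open>3 D\<close>.\<close>

lemma root_spread_bound:
  assumes S: "poly_seminorm S" and R: "resolvent_bounded K S" and A: "annihilates L S"
    and L: "size L = n" and K: "compact K" "convex K" "a \<in> K"
    and x: "x \<notin> K" "cmod (x - a) < D"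
    and near: "\<forall>l\<in>#L. cmod (l - a) \<le> D" and l: "l \<in># L"
  shows "S ([:- l, 1:] * p) \<le> root_spread_const n * D * S p"
proof -
  define C where "C = half_plane_const n"
  have D: "D > 0"
    using x(2) norm_ge_zero[of "x - a"] by linarith
  define b where "b = closest_point K x"
  have cl: "closed K" "K \<noteq> {}" using K compact_imp_closed by auto
  have b: "b \<in> K"
    unfolding b_def by (rule closest_point_in_set[OF cl])
  have bx: "x - b \<noteq> 0" using b x(1) by auto
  have "dist x b \<le> dist x a"
    unfolding b_def by (rule closest_point_le[OF cl(1) K(3)])
  then have ba: "cmod (a - b) \<le> 2 * D"
    using x(2) norm_triangle_ineq4[of "x - b" "x - a"] by (simp add: dist_norm)
  define u where "u = (x - b) /\<^sub>R cmod (x - b)"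
  have u: "cmod u = 1" using bx by (simp add: u_def)
  have H: "\<forall>z\<in>K. inner u (z - b) \<le> 0"
  proof
    fix z assume "z \<in> K"
    then have "inner (x - b) (z - b) \<le> 0"
      unfolding b_def by (rule closest_point_dot[OF K(2) cl(1)])
    then show "inner u (z - b) \<le> 0"
      by (auto simp: u_def intro!: mult_nonneg_nonpos)
  qed
  have lb: "cmod (l - b) \<le> 3 * D" if "l \<in># L" for l
    using near[rule_format, OF that] ba norm_triangle_ineq[of "l - a" "a - b"] by simp
  have "S ([:- b, 1:] * p) \<le> C * (3 * D) * S p"
    using half_plane_bound[OF S R A L u H, of "3 * D" p] D lb by (simp add: C_def)
  moreover have "S ([:- l, 1:] * p) \<le> S ([:- b, 1:] * p) + cmod (l - b) * S p"
    by (rule shift_change[OF S])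
  moreover have "cmod (l - b) * S p \<le> 3 * D * S p"
    by (intro mult_right_mono lb l poly_seminorm_nonneg S)
  ultimately show ?thesis
    by (simp add: root_spread_const_def C_def algebra_simps)
qed

section \<open>Newton interpolation on a disc of comparable size\<close>

lemma synthetic_division_disc_bound:
  assumes D: "D > 0" and M: "\<And>z. cmod (z - c) \<le> D \<Longrightarrow> cmod (poly p z) \<le> M"
    and l: "cmod (l - c) \<le> D / 4"
  obtains q where "p = [:poly p l:] + [:- l, 1:] * q"
    "\<And>z. cmod (z - c) \<le> D \<Longrightarrow> cmod (poly q z) \<le> 4 * M / D"
proof -
  have "[:- l, 1:] dvd p - [:poly p l:]"
    by (simp add: poly_eq_0_iff_dvd[symmetric])
  then obtain q where q: "p - [:poly p l:] = [:- l, 1:] * q" ..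
  have pq: "p = [:poly p l:] + [:- l, 1:] * q"
    using q by (simp add: algebra_simps)
  have "cmod (poly p c) \<le> M" using M D by simp
  then have M0: "M \<ge> 0" using norm_ge_zero[of "poly p c"] by linarith
  have Ml: "cmod (poly p l) \<le> M" using M l D by simp
  \<comment> \<open>On the circle the divisor \<open>z - l\<close> has modulus at least
    \<open>3 D / 4\<close>, because \<open>l\<close> is within \<open>D / 4\<close> of the centre.
    The maximum principle then carries the bound for the quotient into the disc.\<close>
  have *: "cmod (poly q z) \<le> 4 * M / D" if z: "cmod (z - c) = D" for z
  proof -
    have "3 / 4 * D \<le> cmod (z - l)"
      using l z norm_triangle_ineq2[of "z - c" "l - c"] by simp
    then have "3 / 4 * D * cmod (poly q z) \<le> cmod (z - l) * cmod (poly q z)"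
      by (intro mult_right_mono) auto
    also have "\<dots> = cmod (poly (p - [:poly p l:]) z)"
      unfolding q by (simp add: norm_mult[symmetric] algebra_simps)
    also have "\<dots> \<le> 2 * M"
      using norm_triangle_ineq4[of "poly p z" "poly p l"] M[of z] z Ml by simp
    finally have "3 / 4 * D * cmod (poly q z) \<le> 3 * M" using M0 by simp
    then show ?thesis using D by (simp add: field_simps)
  qed
  have "cmod (poly q z) \<le> 4 * M / D" if z: "cmod (z - c) \<le> D" for z
  proof (rule maximum_modulus_frontier[of "poly q" "cball c D"])
    show "poly q holomorphic_on interior (cball c D)"
      by (intro holomorphic_intros)
    show "continuous_on (closure (cball c D)) (poly q)"
      by (intro continuous_intros)
    show "z \<in> cball c D"
      using z by (simp add: dist_norm norm_minus_commute)
    show "cmod (poly q w) \<le> 4 * M / D" if "w \<in> frontier (cball c D)" for w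
      using that D * by (simp add: frontier_cball dist_norm norm_minus_commute)
  qed auto
  with pq that show ?thesis by blast
qed

text \<open>The 1 is the cost of the constant term \<open>p(l)\<close>. The factor 4 is the loss
  \<open>4 / D\<close> of synthetic division, and \<open>C\<close> is the gain \<open>C D\<close>
  from the linear factor: \<open>D\<close> cancels.\<close>

primrec newton_const :: "real \<Rightarrow> nat \<Rightarrow> real" where
  "newton_const C 0 = 0"
| "newton_const C (Suc n) = 1 + 4 * newton_const C n * C"

lemma newton_const_nonneg: "0 \<le> C \<Longrightarrow> 0 \<le> newton_const C n"
  by (induction n) auto

text \<open>Divide off one root, \<open>p = p(l) + (X - l) q\<close>, and apply the induction
  hypothesis to \<open>q\<close> and the shifted seminorm. Distances between roots never enter, so
  colliding roots do no harm.\<close>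

lemma newton_interpolation_bound:
  assumes C: "C \<ge> 0" and "poly_seminorm S" "annihilates L S" "size L = n" and D: "D > 0"
    and "\<forall>l\<in>#L. cmod (l - c) \<le> D / 4" "\<forall>l\<in>#L. \<forall>g. S ([:- l, 1:] * g) \<le> C * D * S g"
    and "\<forall>z. cmod (z - c) \<le> D \<longrightarrow> cmod (poly p z) \<le> M"
  shows "S p \<le> newton_const C n * M * S 1"
  using assms(2-4,6-)
proof (induction n arbitrary: S L M p)
  case 0
  \<comment> \<open>The root polynomial of the empty multiset is 1, so \<open>S\<close> vanishes
    identically.\<close>
  then have "S (1 * p) = 0" unfolding annihilates_def by (metis size_eq_0_iff_empty root_poly_simps(1))
  then show ?case by simp
next
  case (Suc n)
  note S = Suc.prems(1) and A = Suc.prems(2) and L = Suc.prems(3) and near = Suc.prems(4)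
    and lin = Suc.prems(5) and M = Suc.prems(6)
  define B where "B = newton_const C n"
  have B: "B \<ge> 0" using newton_const_nonneg[OF C] by (simp add: B_def)
  obtain l L' where l: "L = add_mset l L'"
    using L by (meson size_eq_Suc_imp_eq_union)
  obtain q where q: "p = [:poly p l:] + [:- l, 1:] * q"
    and qM: "\<And>z. cmod (z - c) \<le> D \<Longrightarrow> cmod (poly q z) \<le> 4 * M / D"
    using synthetic_division_disc_bound[OF D, of c p M l] M near l by auto
  have "cmod (poly p c) \<le> M" using M D by simp
  then have M0: "M \<ge> 0" using norm_ge_zero[of "poly p c"] by linarith
  have "shift_seminorm l S q \<le> B * (4 * M / D) * shift_seminorm l S 1"
  unfolding B_def
  proof (rule Suc.IH[OF poly_seminorm_shift[OF S] annihilates_shift[OF A[unfolded l]]])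
    show "\<forall>k\<in>#L'. \<forall>g. shift_seminorm l S ([:- k, 1:] * g) \<le> C * D * shift_seminorm l S g"
      using lin by (simp add: l shift_seminorm_def mult.left_commute[of "[:- l, 1:]"])
  qed (use L l D near qM in auto)
  also have "\<dots> \<le> B * (4 * M / D) * (C * D * S 1)"
    using lin[rule_format, of l 1] B M0 D
    by (intro mult_left_mono) (auto simp: l shift_seminorm_def)
  also have "\<dots> = 4 * B * C * M * S 1"
    using D by simp
  finally have *: "S ([:- l, 1:] * q) \<le> 4 * B * C * M * S 1"
    by (simp add: shift_seminorm_def)
  have "S p \<le> S [:poly p l:] + S ([:- l, 1:] * q)"
    by (subst q) (rule poly_seminorm_add[OF S])
  also have "[:poly p l:] = Polynomial.smult (poly p l) 1" by simp
  also have "S (Polynomial.smult (poly p l) 1) = cmod (poly p l) * S 1"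
    by (rule poly_seminorm_smult[OF S])
  also have "\<dots> \<le> M * S 1"
  proof (intro mult_right_mono poly_seminorm_nonneg S)
    have "cmod (l - c) \<le> D / 4" using near l by simp
    then have "cmod (l - c) \<le> D" using D by simp
    then show "cmod (poly p l) \<le> M" using M by blast
  qed
  finally show ?case
    using * by (simp add: algebra_simps B_def)
qed

text \<open>A sum, used in place of a maximum, of the constants from the four cases of the induction
  step: a root outside \<open>K\<close>, an interior disc that dominates the root spread, all roots
  at one boundary point, and a dominating root spread.\<close>

primrec calculus_const :: "nat \<Rightarrow> real" where
  "calculus_const 0 = 0"
| "calculus_const (Suc n) = calculus_const n + newton_const (2 * root_spread_const (Suc n)) (Suc n) +
     1 + 10 * calculus_const n * root_spread_const (Suc n)"

lemma calculus_const_nonneg: "0 \<le> calculus_const n"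
  by (induction n) (auto intro!: add_nonneg_nonneg mult_nonneg_nonneg
      root_spread_const_nonneg newton_const_nonneg simp del: newton_const.simps)

text \<open>Let \<open>l\<close> be a root in \<open>K\<close>, \<open>D\<close> its distance to the complement of \<open>K\<close> and \<open>\<rho>\<close> the largest
  distance to another root \<open>k\<close>. If \<open>D\<close> dominates, Newton interpolation on the disc of radius \<open>D\<close>
  works; otherwise \<open>(k - l) p = (X - l) p - (X - k) p\<close>, and \<open>p \<mapsto> S ((X - l) p)\<close> is annihilated by a
  polynomial of smaller degree.\<close>

theorem annihilated_seminorm_bound:
  assumes "poly_seminorm S" "resolvent_bounded K S" "annihilates L S" "size L = n"
    and K: "compact K" "convex K" "K \<noteq> {}" and M: "\<forall>z\<in>K. cmod (poly p z) \<le> M"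
  shows "S p \<le> calculus_const n * M * S 1"
  using assms(1-4)
proof (induction n arbitrary: S L)
  case 0
  then have "S (1 * p) = 0" unfolding annihilates_def by (metis size_eq_0_iff_empty root_poly_simps(1))
  then show ?case by simp
next
  case (Suc n)
  note S = Suc.prems(1) and R = Suc.prems(2) and A = Suc.prems(3) and L = Suc.prems(4)
  define C where "C = calculus_const n"
  define E where "E = root_spread_const (Suc n)"
  define B where "B = newton_const (2 * E) (Suc n)"
  have C: "C \<ge> 0" by (simp add: C_def calculus_const_nonneg)
  have E: "E \<ge> 0" by (simp add: E_def root_spread_const_nonneg)
  have B: "B \<ge> 0" using E newton_const_nonneg[of "2 * E"] by (simp add: B_def del: newton_const.simps)
  note IH = Suc.IH[folded C_def]
  note spread = root_spread_bound[OF S R A L K(1,2), folded E_def]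
  obtain l L' where l: "L = add_mset l L'"
    using L by (meson size_eq_Suc_imp_eq_union)
  have M0: "M \<ge> 0" using M K(3) by (meson ex_in_conv norm_ge_zero order_trans)
  have MS: "0 \<le> M * S 1" by (intro mult_nonneg_nonneg M0 poly_seminorm_nonneg S)
  have suff: "S p \<le> (C + B + 1 + 10 * C * E) * M * S 1"
    if "S p \<le> c * (M * S 1)" "c \<le> C + B + 1 + 10 * C * E" for c
  proof -
    have "c * (M * S 1) \<le> (C + B + 1 + 10 * C * E) * (M * S 1)"
      by (intro mult_right_mono that MS)
    with that show ?thesis by (simp add: mult.assoc)
  qed
  have "S p \<le> (C + B + 1 + 10 * C * E) * M * S 1"
  proof (cases "l \<in> K")
    case False
    define d where "d = infdist l K"
    have d: "d > 0"
      using False K infdist_pos_not_in_closed[of K l] compact_imp_closed[OF K(1)] by (simp add: d_def)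
    have far: "\<forall>w\<in>K. d \<le> cmod (l - w)"
      unfolding d_def by (auto simp flip: dist_norm intro: infdist_le)
    \<comment> \<open>Since \<open>l\<close> has positive distance from \<open>K\<close>,
      multiplication by \<open>l - X\<close> is bounded below, and the factor \<open>X - l\<close>
      can be cancelled from the annihilator.\<close>
    have "annihilates L' S"
      unfolding annihilates_def
    proof
      fix q
      have "d * S (root_poly L' * q) \<le> S ([:l, -1:] * (root_poly L' * q))"
        using R far unfolding resolvent_bounded_def by blast
      also have "[:l, -1:] = - [:- l, 1:]" by simp
      also have "- [:- l, 1:] * (root_poly L' * q) = - (root_poly L * q)"
        by (simp add: l mult.assoc del: minus_pCons)
      also have "S \<dots> = 0"
        using A by (simp add: annihilates_def poly_seminorm_minus[OF S])
      finally show "S (root_poly L' * q) = 0"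
        using d poly_seminorm_nonneg[OF S, of "root_poly L' * q"]
        by (simp add: mult_le_0_iff)
    qed
    then have "S p \<le> C * M * S 1"
      using IH[OF S R, of L'] L l by simp
    then show ?thesis
      using suff[of C] B C E by (simp add: mult.assoc)
  next
    case True
    define D where "D = infdist l (- K)"
    have "- K \<noteq> {}"
      using K(1) compact_imp_bounded not_bounded_UNIV by (metis Compl_empty_eq double_compl)
    \<comment> \<open>The inequality \<open>r > D\<close> is strict because the complement of
      \<open>K\<close> is open and its distance \<open>D\<close> from \<open>l\<close> is not
      attained.\<close>
    have escape: "\<exists>x. x \<notin> K \<and> cmod (x - l) < r" if "r > D" for r
    proof -
      have "\<exists>x\<in>- K. dist l x < r"
      proof (rule ccontr)
        assume "\<not> (\<exists>x\<in>- K. dist l x < r)"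
        then have "r \<le> (INF x\<in>- K. dist l x)"
          using \<open>- K \<noteq> {}\<close> by (intro cINF_greatest) (auto simp: not_less)
        then show False
          using that \<open>- K \<noteq> {}\<close> by (simp add: D_def infdist_notempty)
      qed
      then show ?thesis by (auto simp: dist_norm norm_minus_commute)
    qed
    have disc: "z \<in> K" if "cmod (z - l) < D" for z
      using that infdist_le[of z "- K" l] unfolding D_def
      by (force simp: dist_norm norm_minus_commute)
    have D0: "D \<ge> 0" unfolding D_def by (rule infdist_nonneg)
    define \<rho> where "\<rho> = Max ((\<lambda>k. cmod (k - l)) ` set_mset L)"
    have fin: "finite ((\<lambda>k. cmod (k - l)) ` set_mset L)" "(\<lambda>k. cmod (k - l)) ` set_mset L \<noteq> {}"
      using l by auto
    have rho: "cmod (k - l) \<le> \<rho>" if "k \<in># L" for k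
      unfolding \<rho>_def using fin that by (intro Max_ge) auto
    obtain k where k: "k \<in># L" "cmod (k - l) = \<rho>"
      using Max_in[OF fin] unfolding \<rho>_def by auto
    have rho0: "\<rho> \<ge> 0" using k by auto
    have reach: "S ([:- k, 1:] * g) \<le> E * r * S g" if r: "r > D" "r \<ge> \<rho>" "k \<in># L" for r k g
    proof -
      obtain x where x: "x \<notin> K" "cmod (x - l) < r" using escape[OF r(1)] by blast
      show ?thesis
        using r rho by (intro spread[OF True x]) (auto intro: order_trans)
    qed
    \<comment> \<open>The threshold 4 is what Newton interpolation asks for: roots within
      \<open>D / 4\<close> of the centre. If it fails, \<open>5 * \<rho>\<close> exceeds
      \<open>D\<close>, so a point outside \<open>K\<close> lies within that radius.\<close>
    consider "\<rho> = 0" "D = 0" | "D \<ge> 4 * \<rho>" "D > 0" | "D < 4 * \<rho>" "\<rho> > 0"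
      using D0 rho0 by linarith
    then show ?thesis
    proof cases
      case 1
      \<comment> \<open>All roots coincide with \<open>l\<close>, which lies on the boundary, so
        every positive radius is admissible. Hence \<open>X - l\<close> is null for
        \<open>S\<close>, and \<open>S p\<close> depends on \<open>p(l)\<close> only.\<close>
      have small: "S ([:- l, 1:] * g) \<le> E * \<epsilon> * S g" if "\<epsilon> > 0" for \<epsilon> g
        by (rule reach) (use 1 that l in auto)
      have zero: "S ([:- l, 1:] * g) = 0" for g
      proof -
        have "S ([:- l, 1:] * g) \<le> 0 + e" if e: "e > 0" for e
        proof -
          have Eg: "E * S g \<ge> 0" by (intro mult_nonneg_nonneg E poly_seminorm_nonneg S)
          have "S ([:- l, 1:] * g) \<le> E * (e / (E * S g + 1)) * S g"
            using e Eg by (intro small divide_pos_pos) auto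
          also have "\<dots> = e * (E * S g / (E * S g + 1))" by simp
          also have "\<dots> \<le> e * 1"
            using e Eg by (intro mult_left_mono) (auto simp: field_simps)
          finally show ?thesis by simp
        qed
        then have "S ([:- l, 1:] * g) \<le> 0" by (rule field_le_epsilon)
        then show ?thesis
          using poly_seminorm_nonneg[OF S, of "[:- l, 1:] * g"] by linarith
      qed
      have "[:- l, 1:] dvd p - [:poly p l:]"
        by (simp add: poly_eq_0_iff_dvd[symmetric])
      then have "S (p - Polynomial.smult (poly p l) 1) = 0"
        using zero by (auto elim!: dvdE)
      then have "S p = cmod (poly p l) * S 1"
        using poly_seminorm_eq_mod[OF S] poly_seminorm_smult[OF S] by metis
      also have "\<dots> \<le> 1 * (M * S 1)"
        using M True by (simp add: mult_right_mono poly_seminorm_nonneg[OF S])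
      finally show ?thesis
        by (rule suff) (use C B E in auto)
    next
      case 2
      have "z \<in> K" if "cmod (z - l) \<le> D" for z
      proof -
        have "ball l D \<subseteq> K" using disc by (auto simp: dist_norm norm_minus_commute)
        then have "closure (ball l D) \<subseteq> K"
          using compact_imp_closed[OF K(1)] by (rule closure_minimal)
        then show ?thesis
          using 2 that by (auto simp: dist_norm norm_minus_commute)
      qed
      then have disc': "\<forall>z. cmod (z - l) \<le> D \<longrightarrow> cmod (poly p z) \<le> M"
        using M by blast
      \<comment> \<open>The radius must be strictly larger than \<open>D\<close>; the choice
        \<open>2 * D\<close> accounts for the constant \<open>2 * E\<close>.\<close>
      have "S ([:- k, 1:] * g) \<le> (2 * E) * D * S g" if "k \<in># L" for k g
      proof -
        have "S ([:- k, 1:] * g) \<le> E * (2 * D) * S g"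
          by (rule reach) (use 2 rho0 that in auto)
        then show ?thesis by (simp add: mult.assoc)
      qed
      moreover have "\<forall>k\<in>#L. cmod (k - l) \<le> D / 4"
        using rho 2 by force
      ultimately have "S p \<le> B * M * S 1"
        using newton_interpolation_bound[of "2 * E" S L "Suc n" D l p M] E S A L disc' 2
        by (simp add: B_def mult.commute del: newton_const.simps)
      then show ?thesis
        using suff[of B] C B E by (simp add: mult.assoc)
    next
      case 3
      \<comment> \<open>The induction hypothesis for the shifted seminorm bounds by
        \<open>S ((X - j) 1)\<close>, which is again of order \<open>\<rho>\<close>. Used for the
        two roots \<open>l\<close> and \<open>k\<close>, it gives the factor 10, and division by
        \<open>cmod (k - l) = \<rho>\<close> removes the length.\<close>
      have part: "S ([:- j, 1:] * p) \<le> C * M * (E * (5 * \<rho>) * S 1)" if j: "j \<in># L" for j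
      proof -
        obtain J where J: "L = add_mset j J" using j multi_member_split by metis
        have "S ([:- j, 1:] * 1) \<le> E * (5 * \<rho>) * S 1"
          by (rule reach) (use 3 rho0 j in auto)
        then have "shift_seminorm j S 1 \<le> E * (5 * \<rho>) * S 1"
          by (simp add: shift_seminorm_def)
        moreover have "shift_seminorm j S p \<le> C * M * shift_seminorm j S 1"
          using IH[OF poly_seminorm_shift[OF S] resolvent_bounded_shift[OF R]
              annihilates_shift[OF A[unfolded J]]] L J by simp
        moreover have "C * M * shift_seminorm j S 1 \<le> C * M * (E * (5 * \<rho>) * S 1)"
          using calculation(1) C M0 by (intro mult_left_mono) auto
        ultimately show ?thesis by (simp add: shift_seminorm_def)
      qed
      have "Polynomial.smult (k - l) p = [:- l, 1:] * p - [:- k, 1:] * p"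
        by (simp add: mult_pCons_left smult_diff_left)
      then have "\<rho> * S p \<le> S ([:- l, 1:] * p) + S ([:- k, 1:] * p)"
        using poly_seminorm_smult[OF S, of "k - l" p] k(2)
          poly_seminorm_diff[OF S, of "[:- l, 1:] * p" "[:- k, 1:] * p"] by simp
      also have "\<dots> \<le> \<rho> * (10 * C * E * (M * S 1))"
        using part[of l] part[OF k(1)] l by (simp add: algebra_simps)
      finally have "S p \<le> 10 * C * E * (M * S 1)"
        using 3 by simp
      then show ?thesis
        by (rule suff) (use C B E in auto)
    qed
  qed
  then show ?case
    by (simp add: C_def B_def E_def del: newton_const.simps)
qed

end

section \<open>Functionals and the numerical range\<close>

context unital_normed_algebra
begin

text \<open>The unqualified ring facts refer to \<^const>\<open>complex_ring\<close> here.\<close>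

lemma ring_alg: "ring A"
  using unital_normed_algebra_axioms by (rule unital_normed_algebra.axioms)

lemmas alg_add = ring.ring_simprules(7,10,22)[OF ring_alg]
lemmas alg_neg = ring.ring_simprules(9,16,17,18)[OF ring_alg]
lemmas alg_minus_equality = abelian_group.minus_equality[OF ring.is_abelian_group[OF ring_alg]]
lemmas alg_distr = ring.ring_simprules(13,23)[OF ring_alg]

lemma complex_ring_simps [simp]:
  "carrier complex_ring = UNIV" "mult complex_ring = (*)" "one complex_ring = 1"
  "zero complex_ring = 0" "add complex_ring = (+)"
  by (simp_all add: complex_ring_def)

lemma scale_closed [simp, intro]: "x \<in> carrier A \<Longrightarrow> c \<odot> x \<in> carrier A"
  using smult_closed[of c x] by simp

lemma scale_add_left: "x \<in> carrier A \<Longrightarrow> (c + d) \<odot> x = c \<odot> x \<oplus> d \<odot> x"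
  using smult_l_distr[of c d x] by simp

lemma scale_add_right: "x \<in> carrier A \<Longrightarrow> y \<in> carrier A \<Longrightarrow> c \<odot> (x \<oplus> y) = c \<odot> x \<oplus> c \<odot> y"
  using smult_r_distr[of c x y] by simp

lemma scale_scale: "x \<in> carrier A \<Longrightarrow> c \<odot> (d \<odot> x) = (c * d) \<odot> x"
  using smult_assoc1[of c d x] by simp

lemma scale_one: "x \<in> carrier A \<Longrightarrow> 1 \<odot> x = x"
  using smult_one[of x] by simp

lemma scale_zero: "x \<in> carrier A \<Longrightarrow> 0 \<odot> x = \<zero>"
  using smult_l_null[of x] by simp

lemma scale_zero_right: "c \<odot> \<zero> = \<zero>"
  using smult_r_null[of c] by simp

lemma scale_minus_one: "x \<in> carrier A \<Longrightarrow> (- 1) \<odot> x = \<ominus> x"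
proof -
  assume x: "x \<in> carrier A"
  have "x \<oplus> (- 1) \<odot> x = \<zero>"
    using scale_add_left[OF x, of 1 "-1"] scale_one[OF x] scale_zero[OF x] by simp
  then show ?thesis
    using x alg_minus_equality[of "(- 1) \<odot> x" x] by (simp add: alg_add)
qed

section \<open>The Hahn-Banach theorem for cones of constraints\<close>

text \<open>Only real scalars occur: the algebra is treated as a real vector space until the
  functional is made complex. Values off the carrier are fixed because minimality below is equality
  of total functions.\<close>

definition sublinear :: "('a \<Rightarrow> real) \<Rightarrow> bool" where
  "sublinear q \<longleftrightarrow>
     (\<forall>x\<in>carrier A. \<forall>y\<in>carrier A. q (x \<oplus> y) \<le> q x + q y) \<and>
     (\<forall>t\<ge>0. \<forall>x\<in>carrier A. q (complex_of_real t \<odot> x) = t * q x) \<and>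
     (\<forall>x. x \<notin> carrier A \<longrightarrow> q x = 0)"

lemma sublinear_add:
  "sublinear q \<Longrightarrow> x \<in> carrier A \<Longrightarrow> y \<in> carrier A \<Longrightarrow> q (x \<oplus> y) \<le> q x + q y"
  by (simp add: sublinear_def)

lemma sublinear_scale:
  "sublinear q \<Longrightarrow> t \<ge> 0 \<Longrightarrow> x \<in> carrier A \<Longrightarrow> q (complex_of_real t \<odot> x) = t * q x"
  by (simp add: sublinear_def)

lemma sublinear_zero: "sublinear q \<Longrightarrow> q \<zero> = 0"
  using sublinear_scale[of q 0 \<zero>] by (simp add: scale_zero)

lemma sublinear_lower: "sublinear q \<Longrightarrow> x \<in> carrier A \<Longrightarrow> - q (\<ominus> x) \<le> q x"
  using sublinear_add[of q x "\<ominus> x"] by (simp add: alg_neg sublinear_zero)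

text \<open>A pair \<open>(v, r)\<close> stands for the constraint \<open>- r \<le> f v\<close> on a
  functional \<open>f\<close>. This covers both a single norming condition, which is a ray, and the
  extension of a functional from a subspace, which is a graph.\<close>

definition real_cone :: "('a \<times> real) set \<Rightarrow> bool" where
  "real_cone G \<longleftrightarrow> (\<forall>v r. (v, r) \<in> G \<longrightarrow> v \<in> carrier A) \<and> (\<zero>, 0) \<in> G \<and>
     (\<forall>v r w s. (v, r) \<in> G \<longrightarrow> (w, s) \<in> G \<longrightarrow> (v \<oplus> w, r + s) \<in> G) \<and>
     (\<forall>t v r. t > 0 \<longrightarrow> (v, r) \<in> G \<longrightarrow> (complex_of_real t \<odot> v, t * r) \<in> G)"

lemma real_coneD:
  assumes "real_cone G"
  shows "(v, r) \<in> G \<Longrightarrow> v \<in> carrier A" "(\<zero>, 0) \<in> G"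
    "(v, r) \<in> G \<Longrightarrow> (w, s) \<in> G \<Longrightarrow> (v \<oplus> w, r + s) \<in> G"
    "t > 0 \<Longrightarrow> (v, r) \<in> G \<Longrightarrow> (complex_of_real t \<odot> v, t * r) \<in> G"
  using assms unfolding real_cone_def by blast+

lemma real_cone_ray:
  assumes y: "y \<in> carrier A"
  shows "real_cone ((\<lambda>t. (complex_of_real t \<odot> y, t * c)) ` {0..})"
  unfolding real_cone_def
proof (intro conjI allI impI)
  show "(\<zero>, 0) \<in> (\<lambda>t. (complex_of_real t \<odot> y, t * c)) ` {0..}"
    by (rule image_eqI[of _ _ 0]) (simp_all add: scale_zero[OF y])
next
  fix v w r s
  assume "(v, r) \<in> (\<lambda>t. (complex_of_real t \<odot> y, t * c)) ` {0..}"
    "(w, s) \<in> (\<lambda>t. (complex_of_real t \<odot> y, t * c)) ` {0..}"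
  then obtain a b where "v = complex_of_real a \<odot> y" "r = a * c" "a \<ge> 0"
    "w = complex_of_real b \<odot> y" "s = b * c" "b \<ge> 0"
    by auto
  then show "(v \<oplus> w, r + s) \<in> (\<lambda>t. (complex_of_real t \<odot> y, t * c)) ` {0..}"
    by (intro image_eqI[of _ _ "a + b"]) (simp_all add: scale_add_left[OF y] distrib_right)
next
  fix t v r
  assume "(0::real) < t" "(v, r) \<in> (\<lambda>t. (complex_of_real t \<odot> y, t * c)) ` {0..}"
  then obtain a where "v = complex_of_real a \<odot> y" "r = a * c" "a \<ge> 0" "t > 0"
    by auto
  then show "(complex_of_real t \<odot> v, t * r) \<in> (\<lambda>t. (complex_of_real t \<odot> y, t * c)) ` {0..}"
    by (intro image_eqI[of _ _ "t * a"]) (simp_all add: scale_scale[OF y])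
qed (use y in auto)

text \<open>An infimal convolution: a linear \<open>f\<close> below it satisfies
  \<open>f (- v) \<le> q 0 + r = r\<close>, which is the constraint encoded by
  \<open>(v, r)\<close>.\<close>

definition lower_along :: "('a \<times> real) set \<Rightarrow> ('a \<Rightarrow> real) \<Rightarrow> 'a \<Rightarrow> real" where
  "lower_along G q x = (if x \<in> carrier A then INF (v, r)\<in>G. q (x \<oplus> v) + r else 0)"

text \<open>The hypothesis \<open>pos\<close> keeps the infimum finite: subadditivity gives
  \<open>q v \<le> q (- x) + q (x + v)\<close>, so all its terms are at least
  \<open>- q (- x)\<close>. Sublinearity passes to the infimum because \<open>G\<close> is a
  cone.\<close>

lemma lower_along:
  assumes q: "sublinear q" and G: "real_cone G"
    and pos: "\<And>v r. (v, r) \<in> G \<Longrightarrow> 0 \<le> q v + r"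
  shows sublinear_lower_along: "sublinear (lower_along G q)"
    and lower_along_le: "(v, r) \<in> G \<Longrightarrow> x \<in> carrier A \<Longrightarrow> lower_along G q x \<le> q (x \<oplus> v) + r"
proof -
  note Gc = real_coneD(1)[OF G]
  note G0 = real_coneD(2)[OF G]
  have below: "- q (\<ominus> x) \<le> q (x \<oplus> v) + r" if "x \<in> carrier A" "(v, r) \<in> G" for x v r
  proof -
    have v: "v \<in> carrier A" using Gc that by blast
    have "q v \<le> q (\<ominus> x) + q (x \<oplus> v)"
      using sublinear_add[OF q, of "\<ominus> x" "x \<oplus> v"] that(1) v by (simp add: alg_neg)
    then show ?thesis using pos[OF that(2)] by simp
  qed
  have bdd: "bdd_below ((\<lambda>(v, r). q (x \<oplus> v) + r) ` G)" if "x \<in> carrier A" for x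
    using below[OF that] by (intro bdd_belowI2[where m = "- q (\<ominus> x)"]) auto
  show le: "lower_along G q x \<le> q (x \<oplus> v) + r" if "(v, r) \<in> G" "x \<in> carrier A" for x v r
    using cINF_lower[OF bdd[OF that(2)] that(1)] that(2) by (simp add: lower_along_def)
  have ge: "c \<le> lower_along G q x"
    if "x \<in> carrier A" "\<And>v r. (v, r) \<in> G \<Longrightarrow> c \<le> q (x \<oplus> v) + r" for c x
    using that G0 by (auto simp: lower_along_def intro!: cINF_greatest)
  have scale: "lower_along G q (complex_of_real t \<odot> x) \<le> t * lower_along G q x"
    if t: "t > 0" and x: "x \<in> carrier A" for t x
  proof -
    have "lower_along G q (complex_of_real t \<odot> x) / t \<le> q (x \<oplus> v) + r" if v: "(v, r) \<in> G" for v r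
    proof -
      have "(complex_of_real t \<odot> v, t * r) \<in> G"
        by (rule real_coneD(4)[OF G t v])
      from le[OF this] have "lower_along G q (complex_of_real t \<odot> x)
          \<le> q (complex_of_real t \<odot> (x \<oplus> v)) + t * r"
        using x Gc[OF v] by (simp add: scale_add_right)
      also have "\<dots> = t * (q (x \<oplus> v) + r)"
        using sublinear_scale[OF q, of t "x \<oplus> v"] t x Gc[OF v] by (simp add: distrib_left)
      finally show ?thesis using t by (simp add: field_simps)
    qed
    from ge[OF x this] show ?thesis using t by (simp add: field_simps)
  qed
  show "sublinear (lower_along G q)"
    unfolding sublinear_def
  proof (intro conjI ballI allI impI)
    fix x y assume x: "x \<in> carrier A" and y: "y \<in> carrier A"
    have *: "lower_along G q (x \<oplus> y) \<le> (q (x \<oplus> v) + r) + (q (y \<oplus> w) + s)"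
      if v: "(v, r) \<in> G" and w: "(w, s) \<in> G" for v r w s
    proof -
      have c: "v \<in> carrier A" "w \<in> carrier A" using Gc v w by auto
      have "(v \<oplus> w, r + s) \<in> G"
        by (rule real_coneD(3)[OF G v w])
      from le[OF this] have "lower_along G q (x \<oplus> y) \<le> q ((x \<oplus> y) \<oplus> (v \<oplus> w)) + (r + s)"
        using x y by simp
      also have "(x \<oplus> y) \<oplus> (v \<oplus> w) = (x \<oplus> v) \<oplus> (y \<oplus> w)"
        using x y c by (simp add: alg_add)
      finally show ?thesis
        using sublinear_add[OF q, of "x \<oplus> v" "y \<oplus> w"] x y c by simp
    qed
    have "lower_along G q (x \<oplus> y) - (q (x \<oplus> v) + r) \<le> lower_along G q y" if "(v, r) \<in> G" for v r
      using *[OF that] by (intro ge[OF y]) force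
    then have "lower_along G q (x \<oplus> y) - lower_along G q y \<le> lower_along G q x"
      by (intro ge[OF x]) force
    then show "lower_along G q (x \<oplus> y) \<le> lower_along G q x + lower_along G q y"
      by simp
  next
    fix t x assume t: "(t::real) \<ge> 0" and x: "x \<in> carrier A"
    show "lower_along G q (complex_of_real t \<odot> x) = t * lower_along G q x"
    proof (cases "t = 0")
      case True
      have "lower_along G q \<zero> \<le> 0"
        using le[OF G0, of \<zero>] by (simp add: sublinear_zero[OF q])
      moreover have "0 \<le> lower_along G q \<zero>"
        using pos Gc by (intro ge) auto
      ultimately show ?thesis using True x by (simp add: scale_zero)
    next
      case False
      then have t: "t > 0" using t by simp
      have "lower_along G q (complex_of_real (1 / t) \<odot> (complex_of_real t \<odot> x))
          \<le> 1 / t * lower_along G q (complex_of_real t \<odot> x)"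
        using scale[of "1 / t" "complex_of_real t \<odot> x"] t x by simp
      moreover have "complex_of_real (1 / t) \<odot> (complex_of_real t \<odot> x) = x"
        using x t by (simp add: scale_scale scale_one)
      ultimately show ?thesis
        using scale[OF t x] t by (simp add: field_simps)
    qed
  qed (simp add: lower_along_def)
qed

lemma lower_along_le_self:
  assumes "sublinear q" "real_cone G" "\<And>v r. (v, r) \<in> G \<Longrightarrow> 0 \<le> q v + r"
  shows "lower_along G q x \<le> q x"
proof (cases "x \<in> carrier A")
  case True
  then show ?thesis
    using lower_along_le[OF assms real_coneD(2)[OF assms(2)], of x] True by simp
next
  case False
  then show ?thesis using assms(1) by (simp add: sublinear_def lower_along_def)
qed

text \<open>Zorn's lemma; the pointwise infimum of a nonempty chain is a lower bound, finite because
  a sublinear \<open>f\<close> below \<open>q\<close> satisfies \<open>f x \<ge> - q (- x)\<close>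
  on the carrier.\<close>

lemma minimal_sublinear_exists:
  assumes q: "sublinear q"
  obtains f where "sublinear f" "\<And>x. f x \<le> q x" "\<And>g. sublinear g \<Longrightarrow> (\<And>x. g x \<le> f x) \<Longrightarrow> g = f"
proof -
  define P where "P = {f. sublinear f \<and> (\<forall>x. f x \<le> q x)}"
  \<comment> \<open>The order is reversed, so that maximal elements are minimal functions.\<close>
  define R where "R = (\<lambda>f g :: 'a \<Rightarrow> real. \<forall>x. g x \<le> f x)"
  have po: "partial_order_on P (relation_of R P)"
    by (rule partial_order_on_relation_ofI) (auto simp: R_def fun_eq_iff intro: order_trans order_antisym)
  have "\<exists>u\<in>P. \<forall>f\<in>C. R f u" if C: "C \<in> Chains (relation_of R P)" for C
  proof (cases "C = {}")
    case True
    then show ?thesis using q by (auto simp: P_def)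
  next
    case False
    have CP: "f \<in> P" if "f \<in> C" for f
      using C that by (auto simp: Chains_def relation_of_def)
    have Cs: "sublinear f" if "f \<in> C" for f using CP[OF that] by (simp add: P_def)
    have chain: "(\<forall>x. f x \<le> g x) \<or> (\<forall>x. g x \<le> f x)" if "f \<in> C" "g \<in> C" for f g
      using C that by (auto simp: Chains_def relation_of_def R_def)
    define u where "u = (\<lambda>x. INF f\<in>C. f x)"
    have low: "min 0 (- q (\<ominus> x)) \<le> f x" if "f \<in> C" for f x
    proof (cases "x \<in> carrier A")
      case True
      have "f (\<ominus> x) \<le> q (\<ominus> x)" using CP[OF that] by (simp add: P_def)
      then show ?thesis
        using sublinear_lower[OF Cs[OF that] True] by simp
    next
      case False
      then show ?thesis using Cs[OF that] by (simp add: sublinear_def)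
    qed
    have bdd: "bdd_below ((\<lambda>f. f x) ` C)" for x
      using low by (intro bdd_belowI2) auto
    have ule: "u x \<le> f x" if "f \<in> C" for f x
      unfolding u_def using cINF_lower[OF bdd that] by simp
    have uge: "c \<le> u x" if "\<And>f. f \<in> C \<Longrightarrow> c \<le> f x" for c x
      unfolding u_def using that False by (intro cINF_greatest) auto
    have "sublinear u"
      unfolding sublinear_def
    proof (intro conjI ballI allI impI)
      fix x y assume x: "x \<in> carrier A" and y: "y \<in> carrier A"
      \<comment> \<open>Near-optimal members for \<open>x\<close> and for \<open>y\<close> may
        differ; the smaller of the two serves for both arguments since they are comparable.\<close>
      have *: "u (x \<oplus> y) \<le> f x + g y" if "f \<in> C" "g \<in> C" for f g
        using chain[OF that]
      proof
        assume fg: "\<forall>x. f x \<le> g x"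
        have "u (x \<oplus> y) \<le> f (x \<oplus> y)" by (rule ule[OF that(1)])
        also have "\<dots> \<le> f x + f y" by (rule sublinear_add[OF Cs[OF that(1)] x y])
        finally show ?thesis using fg by (smt (verit))
      next
        assume fg: "\<forall>x. g x \<le> f x"
        have "u (x \<oplus> y) \<le> g (x \<oplus> y)" by (rule ule[OF that(2)])
        also have "\<dots> \<le> g x + g y" by (rule sublinear_add[OF Cs[OF that(2)] x y])
        finally show ?thesis using fg by (smt (verit))
      qed
      have "u (x \<oplus> y) - f x \<le> u y" if "f \<in> C" for f
        using *[OF that] by (intro uge) force
      then have "u (x \<oplus> y) - u y \<le> u x"
        by (intro uge) force
      then show "u (x \<oplus> y) \<le> u x + u y" by simp
    next
      fix t x assume t: "(t::real) \<ge> 0" and x: "x \<in> carrier A"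
      have eq: "f (complex_of_real t \<odot> x) = t * f x" if "f \<in> C" for f
        by (rule sublinear_scale[OF Cs[OF that] t x])
      show "u (complex_of_real t \<odot> x) = t * u x"
      proof (cases "t = 0")
        case True
        then have "(\<lambda>f. f (0 \<odot> x)) ` C = {0}" using eq False by force
        then show ?thesis using True by (simp add: u_def)
      next
        case F: False
        then have "u (complex_of_real t \<odot> x) / t \<le> u x"
          using t ule[of _ "complex_of_real t \<odot> x"] by (intro uge) (simp add: eq field_simps)
        moreover have "t * u x \<le> u (complex_of_real t \<odot> x)"
          using t ule by (intro uge) (simp add: eq mult_left_mono)
        ultimately show ?thesis using F t by (simp add: field_simps)
      qed
    next
      fix x assume "x \<notin> carrier A"
      then have "(\<lambda>f. f x) ` C = {0}" using Cs False by (force simp: sublinear_def)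
      then show "u x = 0" by (simp add: u_def)
    qed
    moreover obtain f where "f \<in> C" using False by blast
    ultimately have "u \<in> P"
      using ule[of f] CP[of f] by (auto simp: P_def intro: order_trans)
    then show ?thesis using ule by (auto simp: R_def)
  qed
  from predicate_Zorn[OF po this] obtain f where f: "f \<in> P" "\<forall>g\<in>P. R f g \<longrightarrow> g = f"
    by blast
  have "g = f" if "sublinear g" "\<And>x. g x \<le> f x" for g
    using f that by (auto simp: P_def R_def intro: order_trans)
  with f that show ?thesis by (auto simp: P_def)
qed

text \<open>A minimal sublinear function is linear: lowering it along the ray of
  \<open>(y, - f y)\<close> must leave it unchanged, and this gives
  \<open>f x + f y \<le> f (x + y)\<close>, the missing half of additivity.\<close>

lemma sublinear_dominates_linear:
  assumes q: "sublinear q"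
  obtains f where "\<And>x. x \<in> carrier A \<Longrightarrow> f x \<le> q x"
    "\<And>x y. x \<in> carrier A \<Longrightarrow> y \<in> carrier A \<Longrightarrow> f (x \<oplus> y) = f x + f y"
    "\<And>t x. x \<in> carrier A \<Longrightarrow> f (complex_of_real t \<odot> x) = t * f x"
proof -
  obtain f where f: "sublinear f" "\<And>x. f x \<le> q x"
      and min: "\<And>g. sublinear g \<Longrightarrow> (\<And>x. g x \<le> f x) \<Longrightarrow> g = f"
    using minimal_sublinear_exists[OF q] by blast
  have add: "f (x \<oplus> y) = f x + f y" if x: "x \<in> carrier A" and y: "y \<in> carrier A" for x y
  proof -
    define G where "G = (\<lambda>t. (complex_of_real t \<odot> y, t * - f y)) ` {0..}"
    have G: "real_cone G"
      unfolding G_def by (rule real_cone_ray[OF y])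
    have pos: "0 \<le> f v + r" if "(v, r) \<in> G" for v r
      using that y by (auto simp: G_def sublinear_scale[OF f(1)])
    have "lower_along G f = f"
      by (rule min) (use sublinear_lower_along[OF f(1) G pos] lower_along_le_self[OF f(1) G pos] in auto)
    moreover have "(y, - f y) \<in> G"
      using y by (auto simp: G_def scale_one intro!: image_eqI[of _ _ 1])
    ultimately have "f x \<le> f (x \<oplus> y) - f y"
      using lower_along_le[OF f(1) G pos, of y "- f y" x] x by simp
    then show ?thesis using sublinear_add[OF f(1) x y] by simp
  qed
  have "f (complex_of_real t \<odot> x) = t * f x" if x: "x \<in> carrier A" for t x
  proof (cases "t \<ge> 0")
    case True
    then show ?thesis using sublinear_scale[OF f(1)] x by blast
  next
    case False
    have "f (complex_of_real t \<odot> x) + f (complex_of_real (- t) \<odot> x) = f \<zero>"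
      using add[of "complex_of_real t \<odot> x" "complex_of_real (- t) \<odot> x"] x
        scale_add_left[of x "complex_of_real t" "complex_of_real (- t)"] by (simp add: scale_zero)
    then show ?thesis
      using sublinear_scale[OF f(1), of "- t" x] False x sublinear_zero[OF f(1)] by simp
  qed
  with add f(2) that show ?thesis by blast
qed

definition contractive_functional :: "('a \<Rightarrow> complex) \<Rightarrow> bool" where
  "contractive_functional \<phi> \<longleftrightarrow>
     (\<forall>x\<in>carrier A. \<forall>y\<in>carrier A. \<phi> (x \<oplus> y) = \<phi> x + \<phi> y) \<and>
     (\<forall>c. \<forall>x\<in>carrier A. \<phi> (c \<odot> x) = c * \<phi> x) \<and>
     (\<forall>x\<in>carrier A. cmod (\<phi> x) \<le> anorm A x)"

theorem hahn_banach_cone: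
  assumes G: "real_cone G" and pos: "\<And>v r. (v, r) \<in> G \<Longrightarrow> 0 \<le> anorm A v + r"
  obtains \<phi> where "contractive_functional \<phi>" "\<And>v r. (v, r) \<in> G \<Longrightarrow> - r \<le> Re (\<phi> v)"
proof -
  define N where "N = (\<lambda>x. if x \<in> carrier A then anorm A x else 0)"
  have N: "sublinear N"
    by (auto simp: sublinear_def N_def anorm_add anorm_smult)
  note Gc = real_coneD(1)[OF G]
  have posN: "0 \<le> N v + r" if "(v, r) \<in> G" for v r
    using pos[OF that] Gc[OF that] by (simp add: N_def)
  obtain f where f_le: "\<And>x. x \<in> carrier A \<Longrightarrow> f x \<le> lower_along G N x"
    and f_add: "\<And>x y. x \<in> carrier A \<Longrightarrow> y \<in> carrier A \<Longrightarrow> f (x \<oplus> y) = f x + f y"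
    and f_scale: "\<And>t x. x \<in> carrier A \<Longrightarrow> f (complex_of_real t \<odot> x) = t * f x"
    using sublinear_dominates_linear[OF sublinear_lower_along[OF N G posN]] by blast
  have f_neg: "f (\<ominus> x) = - f x" if "x \<in> carrier A" for x
    using f_scale[OF that, of "-1"] scale_minus_one[OF that] by simp
  have fN: "f x \<le> anorm A x" if "x \<in> carrier A" for x
    using f_le[OF that] lower_along_le_self[OF N G posN, of x] that by (simp add: N_def)
  \<comment> \<open>The usual complexification \<open>f x - i f (i x)\<close>, the complex linear
    functional with real part \<open>f\<close>.\<close>
  define \<phi> where "\<phi> = (\<lambda>x. Complex (f x) (- f (\<i> \<odot> x)))"
  have add: "\<phi> (x \<oplus> y) = \<phi> x + \<phi> y" if "x \<in> carrier A" "y \<in> carrier A" for x y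
    using that by (simp add: \<phi>_def complex_eq_iff scale_add_right f_add)
  have scale: "\<phi> (c \<odot> x) = c * \<phi> x" if x: "x \<in> carrier A" for c x
  proof -
    have split: "f (c \<odot> x) = Re c * f x + Im c * f (\<i> \<odot> x)" for c
    proof -
      have "c \<odot> x = complex_of_real (Re c) \<odot> x \<oplus> complex_of_real (Im c) \<odot> (\<i> \<odot> x)"
        using x complex_eq[of c] by (simp add: scale_scale mult.commute flip: scale_add_left)
      then show ?thesis using x by (simp add: f_add f_scale)
    qed
    show ?thesis
      using x split[of c] split[of "\<i> * c"] by (simp add: \<phi>_def complex_eq_iff scale_scale)
  qed
  have "cmod (\<phi> x) \<le> anorm A x" if x: "x \<in> carrier A" for x
  proof (cases "\<phi> x = 0")
    case True
    then show ?thesis using anorm_nonneg x by simp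
  next
    case False
    \<comment> \<open>This unimodular factor rotates \<open>\<phi> x\<close> onto the positive axis,
      where \<open>\<phi>\<close> agrees with its real part \<open>f\<close>.\<close>
    define c where "c = cnj (\<phi> x) / cmod (\<phi> x)"
    have c: "cmod c = 1" using False by (simp add: c_def norm_divide)
    have "\<phi> (c \<odot> x) = complex_of_real (cmod (\<phi> x))"
      using False by (simp add: scale[OF x] c_def complex_norm_square[symmetric] power2_eq_square mult.commute)
    then have "cmod (\<phi> x) = f (c \<odot> x)"
      by (simp add: \<phi>_def complex_eq_iff)
    also have "\<dots> \<le> anorm A x"
      using fN[of "c \<odot> x"] x c by (simp add: anorm_smult)
    finally show ?thesis .
  qed
  with add scale have "contractive_functional \<phi>"
    by (simp add: contractive_functional_def)
  moreover have "- r \<le> Re (\<phi> v)" if v: "(v, r) \<in> G" for v r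
  proof -
    \<comment> \<open>At \<open>- v\<close> the translate by \<open>v\<close> is zero, so only
      \<open>r\<close> remains.\<close>
    have "f (\<ominus> v) \<le> N (\<ominus> v \<oplus> v) + r"
      using f_le[of "\<ominus> v"] lower_along_le[OF N G posN v, of "\<ominus> v"] Gc[OF v] by simp
    then show ?thesis
      using Gc[OF v] by (simp add: f_neg alg_neg sublinear_zero[OF N] \<phi>_def)
  qed
  ultimately show ?thesis using that by blast
qed

text \<open>The ray imposes \<open>Re (\<phi> y) \<ge> anorm A y\<close>; together with
  contractivity this leaves no room for an imaginary part.\<close>

lemma norming_functional:
  assumes y: "y \<in> carrier A"
  obtains \<phi> where "contractive_functional \<phi>" "\<phi> y = anorm A y"
proof -
  define G where "G = (\<lambda>t. (complex_of_real t \<odot> y, t * - anorm A y)) ` {0..}"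
  have G: "real_cone G"
    unfolding G_def by (rule real_cone_ray[OF y])
  have "0 \<le> anorm A v + r" if "(v, r) \<in> G" for v r
    using that y by (auto simp: G_def anorm_smult)
  then obtain \<phi> where \<phi>: "contractive_functional \<phi>" "\<And>v r. (v, r) \<in> G \<Longrightarrow> - r \<le> Re (\<phi> v)"
    using hahn_banach_cone[OF G] by blast
  have "(y, - anorm A y) \<in> G"
    using y by (auto simp: G_def scale_one intro!: image_eqI[of _ _ 1])
  then have "anorm A y \<le> Re (\<phi> y)" using \<phi>(2) by fastforce
  moreover have "cmod (\<phi> y) \<le> anorm A y"
    using \<phi>(1) y by (simp add: contractive_functional_def)
  ultimately have re: "Re (\<phi> y) = anorm A y" and "(cmod (\<phi> y))\<^sup>2 \<le> (anorm A y)\<^sup>2"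
    using complex_Re_le_cmod[of "\<phi> y"] by (auto intro: power_mono)
  then have "Im (\<phi> y) = 0"
    by (simp add: cmod_power2)
  with re have "\<phi> y = anorm A y"
    by (simp add: complex_eq_iff)
  then show ?thesis using that \<phi>(1) by blast
qed

section \<open>States and the numerical range\<close>

lemma dual_norm_le:
  assumes "\<phi> \<in> dual_space A" "x \<in> carrier A"
  shows "cmod (\<phi> x) \<le> dual_norm A \<phi> * anorm A x"
proof (cases "anorm A x = 0")
  case True
  then have "x = \<zero>" using assms anorm_eq_0 by simp
  moreover have "\<phi> (0 \<odot> \<zero>) = 0 * \<phi> \<zero>"
    using assms(1) ring.ring_simprules(2)[OF ring_alg] unfolding dual_space_def by blast
  then have "\<phi> \<zero> = 0"
    by (simp add: scale_zero)
  ultimately show ?thesis using True by simp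
next
  case False
  then have pos: "anorm A x > 0" using anorm_nonneg[OF assms(2)] by simp
  obtain B where B: "\<And>x. x \<in> carrier A \<Longrightarrow> cmod (\<phi> x) \<le> B * anorm A x"
    using assms(1) unfolding dual_space_def by blast
  have "cmod (\<phi> x) \<le> \<bar>B\<bar>" if "x \<in> carrier A" "anorm A x \<le> 1" for x
  proof -
    have "cmod (\<phi> x) \<le> \<bar>B\<bar> * anorm A x"
      using B[OF that(1)] mult_right_mono[OF abs_ge_self anorm_nonneg[OF that(1)]]
      by (rule order_trans)
    also have "\<dots> \<le> \<bar>B\<bar> * 1" by (intro mult_left_mono that) auto
    finally show ?thesis by simp
  qed
  then have bdd: "bdd_above ((\<lambda>x. cmod (\<phi> x)) ` {x \<in> carrier A. anorm A x \<le> 1})"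
    by (intro bdd_aboveI2[where M = "\<bar>B\<bar>"]) auto
  define y where "y = complex_of_real (1 / anorm A x) \<odot> x"
  have "anorm A y = 1"
    using assms(2) pos anorm_smult[OF assms(2), of "complex_of_real (1 / anorm A x)"]
    by (simp add: y_def norm_divide)
  then have "cmod (\<phi> y) \<le> dual_norm A \<phi>"
    unfolding dual_norm_def using assms(2) by (intro cSUP_upper bdd) (auto simp: y_def)
  moreover have "\<phi> y = complex_of_real (1 / anorm A x) * \<phi> x"
    using assms by (simp add: dual_space_def y_def)
  ultimately show ?thesis
    using pos by (simp add: norm_divide field_simps norm_mult)
qed

text \<open>A contractive functional with value 1 at the unit has norm exactly 1, because the unit
  has norm one. This form avoids the supremum in \<open>dual_norm\<close>.\<close>

lemma numerical_range_iff:
  "z \<in> numerical_range A a \<longleftrightarrow> (\<exists>\<phi>. contractive_functional \<phi> \<and> \<phi> \<one> = 1 \<and> z = \<phi> a)"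
proof
  assume "z \<in> numerical_range A a"
  then obtain \<phi> where \<phi>: "\<phi> \<in> dual_space A" "dual_norm A \<phi> = 1" "\<phi> \<one> = 1" "z = \<phi> a"
    by (auto simp: numerical_range_def)
  then have "contractive_functional \<phi>"
    using dual_norm_le[OF \<phi>(1)] by (auto simp: contractive_functional_def dual_space_def)
  with \<phi> show "\<exists>\<phi>. contractive_functional \<phi> \<and> \<phi> \<one> = 1 \<and> z = \<phi> a" by blast
next
  assume "\<exists>\<phi>. contractive_functional \<phi> \<and> \<phi> \<one> = 1 \<and> z = \<phi> a"
  then obtain \<phi> where \<phi>: "contractive_functional \<phi>" "\<phi> \<one> = 1" "z = \<phi> a" by blast
  then have D: "\<phi> \<in> dual_space A"
    by (auto simp: contractive_functional_def dual_space_def intro: exI[of _ 1])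
  have "dual_norm A \<phi> \<le> 1"
    unfolding dual_norm_def
  proof (rule cSUP_least)
    show "{x \<in> carrier A. anorm A x \<le> 1} \<noteq> {}"
      using anorm_one by (auto intro!: exI[of _ \<one>])
    show "cmod (\<phi> x) \<le> 1" if "x \<in> {x \<in> carrier A. anorm A x \<le> 1}" for x
      using that \<phi>(1) by (force simp: contractive_functional_def)
  qed
  moreover have "1 \<le> dual_norm A \<phi>"
    using dual_norm_le[OF D, of \<one>] \<phi>(2) anorm_one by simp
  ultimately show "z \<in> numerical_range A a"
    using D \<phi> by (auto simp: numerical_range_def)
qed

lemma numerical_range_nonempty: "numerical_range A a \<noteq> {}"
proof -
  obtain \<phi> where "contractive_functional \<phi>" "\<phi> \<one> = anorm A \<one>"
    using norming_functional[of \<one>] by auto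
  then have "\<phi> a \<in> numerical_range A a"
    using numerical_range_iff anorm_one by auto
  then show ?thesis by blast
qed

lemma numerical_range_norm_le:
  "a \<in> carrier A \<Longrightarrow> z \<in> numerical_range A a \<Longrightarrow> cmod z \<le> anorm A a"
  by (auto simp: numerical_range_iff contractive_functional_def)

lemma convex_numerical_range:
  assumes "a \<in> carrier A"
  shows "convex (numerical_range A a)"
proof (rule convexI)
  fix z w :: complex and s t :: real
  assume "z \<in> numerical_range A a" "w \<in> numerical_range A a" and st: "0 \<le> s" "0 \<le> t" "s + t = 1"
  then obtain \<phi> \<psi> where p: "contractive_functional \<phi>" "\<phi> \<one> = 1" "z = \<phi> a"
    "contractive_functional \<psi>" "\<psi> \<one> = 1" "w = \<psi> a"
    by (auto simp: numerical_range_iff)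
  define \<omega> where "\<omega> = (\<lambda>x. complex_of_real s * \<phi> x + complex_of_real t * \<psi> x)"
  have "cmod (\<omega> x) \<le> anorm A x" if "x \<in> carrier A" for x
  proof -
    have "cmod (\<omega> x) \<le> s * cmod (\<phi> x) + t * cmod (\<psi> x)"
      unfolding \<omega>_def using norm_triangle_ineq[of "s * \<phi> x" "t * \<psi> x"] st by (simp add: norm_mult)
    also have "\<dots> \<le> s * anorm A x + t * anorm A x"
      using p(1,4) that st unfolding contractive_functional_def by (intro add_mono mult_left_mono) auto
    also have "\<dots> = anorm A x" using st by (simp flip: distrib_right)
    finally show ?thesis .
  qed
  then have "contractive_functional \<omega>"
    using p(1,4) by (auto simp: contractive_functional_def \<omega>_def algebra_simps)
  moreover have "\<omega> \<one> = 1" using p(2,5) st by (simp add: \<omega>_def flip: of_real_add)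
  moreover have "s *\<^sub>R z + t *\<^sub>R w = \<omega> a" by (simp add: \<omega>_def p scaleR_conv_of_real)
  ultimately show "s *\<^sub>R z + t *\<^sub>R w \<in> numerical_range A a"
    using numerical_range_iff by blast
qed

lemma range_sup_bdd:
  assumes "a \<in> carrier A"
  shows "bdd_above ((\<lambda>z. cmod (poly p z)) ` numerical_range A a)"
proof -
  have "bounded (numerical_range A a)"
    using numerical_range_norm_le[OF assms] by (auto simp: bounded_iff)
  then have "compact (closure (numerical_range A a))" by simp
  then have "bounded ((\<lambda>z. cmod (poly p z)) ` closure (numerical_range A a))"
    by (intro compact_imp_bounded compact_continuous_image continuous_intros)
  then show ?thesis
    using bounded_imp_bdd_above bounded_subset closure_subset by (metis image_mono)
qed

text \<open>The seminorm argument wants a compact set, so it is run on the closure of the numerical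
  range; by continuity the closure has the same supremum.\<close>

lemma poly_le_range_sup:
  assumes "a \<in> carrier A" "z \<in> closure (numerical_range A a)"
  shows "cmod (poly p z) \<le> range_sup A a p"
proof -
  have "(\<lambda>z. cmod (poly p z)) ` closure (numerical_range A a) \<subseteq> {..range_sup A a p}"
  proof (rule image_closure_subset)
    show "(\<lambda>z. cmod (poly p z)) ` numerical_range A a \<subseteq> {..range_sup A a p}"
      unfolding range_sup_def using cSUP_upper[OF _ range_sup_bdd[OF assms(1)]] by auto
  qed (auto intro!: continuous_intros)
  then show ?thesis using assms(2) by auto
qed

lemma range_sup_nonneg: "a \<in> carrier A \<Longrightarrow> 0 \<le> range_sup A a p"
  using numerical_range_nonempty[of a] poly_le_range_sup[of a _ p] closure_subset norm_ge_zero
  by (metis all_not_in_conv in_mono order_trans)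

text \<open>A functional \<open>f\<close> norming \<open>y\<close> gives the state \<open>x \<mapsto> f (x y)\<close> up to scaling.\<close>

lemma anorm_resolvent_lower:
  assumes a: "a \<in> carrier A" and y: "y \<in> carrier A"
    and d: "\<And>w. w \<in> numerical_range A a \<Longrightarrow> d \<le> cmod (z - w)"
  shows "d * anorm A y \<le> anorm A (z \<odot> y \<oplus> (- 1) \<odot> (a \<otimes> y))"
proof (cases "anorm A y = 0")
  case True
  then show ?thesis using a y by (auto intro: anorm_nonneg)
next
  case False
  then have pos: "anorm A y > 0" using anorm_nonneg[OF y] by simp
  obtain f where f: "contractive_functional f" "f y = anorm A y"
    using norming_functional[OF y] by blast
  define \<phi> where "\<phi> = (\<lambda>x. f (x \<otimes> y) / anorm A y)"
  have "cmod (\<phi> x) \<le> anorm A x" if "x \<in> carrier A" for x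
  proof -
    have "cmod (f (x \<otimes> y)) \<le> anorm A (x \<otimes> y)"
      using f that y by (simp add: contractive_functional_def)
    also have "\<dots> \<le> anorm A x * anorm A y" by (rule anorm_mult[OF that y])
    finally show ?thesis using pos by (simp add: \<phi>_def norm_divide field_simps)
  qed
  then have "contractive_functional \<phi>"
    using f(1) y by (auto simp: contractive_functional_def \<phi>_def alg_distr smult_mult_left add_divide_distrib)
  moreover have "\<phi> \<one> = 1" using y f(2) pos by (simp add: \<phi>_def)
  ultimately have "d \<le> cmod (z - \<phi> a)"
    using d numerical_range_iff by blast
  then have "d * anorm A y \<le> cmod (z - \<phi> a) * anorm A y"
    using pos by simp
  also have "\<dots> = cmod ((z - \<phi> a) * anorm A y)"
    using pos by (simp add: norm_mult)
  also have "(z - \<phi> a) * anorm A y = f (z \<odot> y \<oplus> (- 1) \<odot> (a \<otimes> y))"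
    using f a y pos by (simp add: contractive_functional_def \<phi>_def algebra_simps)
  also have "cmod \<dots> \<le> anorm A (z \<odot> y \<oplus> (- 1) \<odot> (a \<otimes> y))"
  proof -
    have "z \<odot> y \<oplus> (- 1) \<odot> (a \<otimes> y) \<in> carrier A"
      using a y by simp
    then show "cmod (f (z \<odot> y \<oplus> (- 1) \<odot> (a \<otimes> y))) \<le> anorm A (z \<odot> y \<oplus> (- 1) \<odot> (a \<otimes> y))"
      using f(1) unfolding contractive_functional_def by blast
  qed
  finally show ?thesis .
qed

subsection \<open>Polynomials in an element\<close>

lemmas alg_closed = ring.ring_simprules(1,2,5,6)[OF ring_alg]
lemmas alg_unit = ring.ring_simprules(8,12,15,24,25)[OF ring_alg]
lemmas alg_assoc = ring.ring_simprules(11)[OF ring_alg]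

lemma r_one_alg: "x \<in> carrier A \<Longrightarrow> x \<otimes> \<one> = x"
  using ring.is_monoid[OF ring_alg] by (rule monoid.r_one)

lemma pow_closed [simp]: "a \<in> carrier A \<Longrightarrow> a [^] (i::nat) \<in> carrier A"
  using ring.is_monoid[OF ring_alg] by (simp add: monoid.nat_pow_closed)

lemma abelian_monoid_alg: "abelian_monoid A"
  using abelian_group.axioms(1)[OF ring.is_abelian_group[OF ring_alg]] .

lemma semiring_alg: "semiring A"
  by unfold_locales

lemma poly_eval_upto:
  assumes a: "a \<in> carrier A" and N: "degree p \<le> N"
  shows "poly_eval A p a = (\<Oplus>i\<in>{..N}. coeff p i \<odot> (a [^] i))"
  using N
proof (induction N rule: dec_induct)
  case base
  show ?case by (simp add: poly_eval_def)
next
  case (step N)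
  have "(\<Oplus>i\<in>{..Suc N}. coeff p i \<odot> (a [^] i))
      = coeff p (Suc N) \<odot> (a [^] Suc N) \<oplus> (\<Oplus>i\<in>{..N}. coeff p i \<odot> (a [^] i))"
    using a by (intro abelian_monoid.finsum_Suc[OF abelian_monoid_alg]) (auto simp del: nat_pow_Suc)
  moreover have "coeff p (Suc N) = 0"
    using step by (simp add: coeff_eq_0)
  ultimately show ?case
    using a step abelian_monoid.finsum_closed[OF abelian_monoid_alg, of "\<lambda>i. coeff p i \<odot> (a [^] i)" "{..N}"]
    by (simp add: scale_zero alg_unit Pi_def)
qed

lemma poly_eval_closed [simp]: "a \<in> carrier A \<Longrightarrow> poly_eval A p a \<in> carrier A"
  unfolding poly_eval_def using abelian_monoid.finsum_closed[OF abelian_monoid_alg] by auto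

lemma poly_eval_add:
  assumes a: "a \<in> carrier A"
  shows "poly_eval A (p + q) a = poly_eval A p a \<oplus> poly_eval A q a"
proof -
  define N where "N = max (degree p) (degree q)"
  have "poly_eval A (p + q) a = (\<Oplus>i\<in>{..N}. coeff p i \<odot> (a [^] i) \<oplus> coeff q i \<odot> (a [^] i))"
    using a degree_add_le_max[of p q] by (simp add: poly_eval_upto[of a _ N] N_def scale_add_left)
  also have "\<dots> = (\<Oplus>i\<in>{..N}. coeff p i \<odot> (a [^] i)) \<oplus> (\<Oplus>i\<in>{..N}. coeff q i \<odot> (a [^] i))"
    using a by (intro abelian_monoid.finsum_addf[OF abelian_monoid_alg]) auto
  also have "\<dots> = poly_eval A p a \<oplus> poly_eval A q a"
    using a by (simp add: poly_eval_upto[of a _ N] N_def)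
  finally show ?thesis .
qed

lemma poly_eval_0: "a \<in> carrier A \<Longrightarrow> poly_eval A 0 a = \<zero>"
  using abelian_monoid.finsum_zero[OF abelian_monoid_alg, of "{..0::nat}"]
  by (simp add: poly_eval_def scale_zero)

lemma poly_eval_pCons:
  assumes a: "a \<in> carrier A"
  shows "poly_eval A (pCons c p) a = c \<odot> \<one> \<oplus> a \<otimes> poly_eval A p a"
proof -
  define N where "N = degree p"
  have "poly_eval A (pCons c p) a = (\<Oplus>i\<in>{..Suc N}. coeff (pCons c p) i \<odot> (a [^] i))"
    using a degree_pCons_le[of c p] by (intro poly_eval_upto) (auto simp: N_def)
  also have "\<dots> = (\<Oplus>i\<in>{..N}. coeff p i \<odot> (a [^] Suc i)) \<oplus> c \<odot> (a [^] (0::nat))"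
    using a by (subst abelian_monoid.finsum_Suc2[OF abelian_monoid_alg]) auto
  also have "(\<Oplus>i\<in>{..N}. coeff p i \<odot> (a [^] Suc i)) = (\<Oplus>i\<in>{..N}. a \<otimes> (coeff p i \<odot> (a [^] i)))"
    using a monoid.nat_pow_Suc2[OF ring.is_monoid[OF ring_alg] a]
    by (intro abelian_monoid.finsum_cong'[OF abelian_monoid_alg]) (auto simp: smult_mult_right)
  also have "\<dots> = a \<otimes> (\<Oplus>i\<in>{..N}. coeff p i \<odot> (a [^] i))"
    using a by (intro semiring.finsum_rdistr[OF semiring_alg, symmetric]) auto
  also have "\<dots> = a \<otimes> poly_eval A p a"
    by (simp add: poly_eval_def N_def)
  also have "a [^] (0::nat) = \<one>"
    by (rule monoid.nat_pow_0[OF ring.is_monoid[OF ring_alg]])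
  finally show ?thesis
    using a by (simp add: alg_add)
qed

lemma poly_eval_smult:
  assumes a: "a \<in> carrier A"
  shows "poly_eval A (Polynomial.smult c p) a = c \<odot> poly_eval A p a"
proof (induction p)
  case 0
  then show ?case using a by (simp add: poly_eval_0 scale_zero_right)
next
  case (pCons b p)
  then show ?case
    using a by (simp add: poly_eval_pCons scale_add_right scale_scale smult_mult_right)
qed

lemma poly_eval_1: "a \<in> carrier A \<Longrightarrow> poly_eval A 1 a = \<one>"
  unfolding one_pCons by (simp add: poly_eval_pCons poly_eval_0 scale_one alg_unit)

lemma poly_eval_X: "a \<in> carrier A \<Longrightarrow> poly_eval A [:0, 1:] a = a"
  by (simp add: poly_eval_pCons poly_eval_0 scale_one scale_zero alg_unit r_one_alg)

lemma poly_eval_mult: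
  assumes a: "a \<in> carrier A"
  shows "poly_eval A (p * q) a = poly_eval A p a \<otimes> poly_eval A q a"
proof (induction p)
  case 0
  then show ?case using a by (simp add: poly_eval_0 alg_unit)
next
  case (pCons c p)
  then show ?case
    using a by (simp add: mult_pCons_left poly_eval_add poly_eval_smult poly_eval_pCons
        scale_zero alg_unit alg_distr alg_assoc smult_mult_left)
qed

lemma anorm_zero: "anorm A \<zero> = 0"
  using anorm_eq_0[of \<zero>] by (simp add: alg_closed)

lemma poly_seminorm_eval:
  assumes a: "a \<in> carrier A"
  shows "poly_seminorm (\<lambda>p. anorm A (poly_eval A p a))"
  using a by (simp add: poly_seminorm_def poly_eval_add poly_eval_smult anorm_add anorm_smult)

lemma resolvent_bounded_eval:
  assumes a: "a \<in> carrier A"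
  shows "resolvent_bounded (closure (numerical_range A a)) (\<lambda>p. anorm A (poly_eval A p a))"
  unfolding resolvent_bounded_def
proof (intro allI impI)
  fix z d p
  assume d: "\<forall>w\<in>closure (numerical_range A a). d \<le> cmod (z - w)"
  have "[:z, -1:] * p = Polynomial.smult z p + Polynomial.smult (-1) ([:0, 1:] * p)"
    by (simp add: mult_pCons_left)
  then have "poly_eval A ([:z, -1:] * p) a
      = z \<odot> poly_eval A p a \<oplus> (- 1) \<odot> (a \<otimes> poly_eval A p a)"
    using a by (simp only: poly_eval_add poly_eval_smult poly_eval_mult poly_eval_X)
  then show "d * anorm A (poly_eval A p a) \<le> anorm A (poly_eval A ([:z, -1:] * p) a)"
    using anorm_resolvent_lower[OF a, of "poly_eval A p a" d z] d a closure_subset by force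
qed

lemma compact_convex_closure_range:
  assumes "a \<in> carrier A"
  shows "compact (closure (numerical_range A a))" "convex (closure (numerical_range A a))"
    "closure (numerical_range A a) \<noteq> {}"
proof -
  have "bounded (numerical_range A a)"
    using numerical_range_norm_le[OF assms] by (auto simp: bounded_iff)
  then show "compact (closure (numerical_range A a))" by simp
  show "convex (closure (numerical_range A a))"
    by (rule convex_closure[OF convex_numerical_range[OF assms]])
  show "closure (numerical_range A a) \<noteq> {}"
    using numerical_range_nonempty by simp
qed

theorem poly_eval_bound:
  assumes a: "a \<in> carrier A" and m: "m \<noteq> 0" "degree m \<le> n" "poly_eval A m a = \<zero>"
  shows "anorm A (poly_eval A p a) \<le> calculus_const n * range_sup A a p"
proof -
  obtain R where R: "size R = degree m" "m = Polynomial.smult (lead_coeff m) (root_poly R)"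
    using alg_closed_imp_factorization[OF m(1)] unfolding root_poly_def by blast
  \<comment> \<open>Zeros fill the multiset up to exactly \<open>n\<close> elements, as the
    induction counts them; multiples of the longer product are still multiples of
    \<open>m\<close>.\<close>
  define L where "L = R + replicate_mset (n - degree m) 0"
  have "annihilates L (\<lambda>p. anorm A (poly_eval A p a))"
    unfolding annihilates_def
  proof
    fix q
    have "root_poly L = root_poly (replicate_mset (n - degree m) 0) * root_poly R"
      by (simp add: root_poly_def L_def)
    also have "root_poly R = Polynomial.smult (inverse (lead_coeff m)) m"
      by (subst R(2)) (use m in simp)
    finally have "root_poly L * q = (Polynomial.smult (inverse (lead_coeff m))
        (root_poly (replicate_mset (n - degree m) 0)) * q) * m"
      by (simp add: algebra_simps)
    then show "anorm A (poly_eval A (root_poly L * q) a) = 0"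
      using a m by (simp only: poly_eval_mult alg_unit alg_closed poly_eval_closed anorm_zero)
  qed
  moreover have "size L = n"
    using R(1) m(2) by (simp add: L_def)
  ultimately have "anorm A (poly_eval A p a)
      \<le> calculus_const n * range_sup A a p * anorm A (poly_eval A 1 a)"
    using annihilated_seminorm_bound[OF poly_seminorm_eval[OF a] resolvent_bounded_eval[OF a] _ _
        compact_convex_closure_range[OF a]] poly_le_range_sup[OF a] by blast
  then show ?thesis
    using a by (simp add: poly_eval_1 anorm_one)
qed

text \<open>The general constant is 2 for \<open>n = 1\<close>, so the sharp bound needs its own
  argument: \<open>a\<close> is a scalar \<open>l\<close>, the number \<open>l\<close> lies in the
  closed numerical range, and \<open>p(a)\<close> is the scalar \<open>p(l)\<close>.\<close>

lemma scalar_poly_eval_bound: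
  assumes a: "a \<in> carrier A" and m: "m \<noteq> 0" "degree m \<le> 1" "poly_eval A m a = \<zero>"
  shows "anorm A (poly_eval A p a) \<le> range_sup A a p"
proof -
  have "degree m \<noteq> 0"
  proof
    assume "degree m = 0"
    then obtain c where c: "m = Polynomial.smult c 1" by (auto elim: degree_eq_zeroE)
    then have "c \<odot> \<one> = \<zero>"
      using a m(3) by (simp only: poly_eval_smult poly_eval_1)
    then have "cmod c * anorm A \<one> = 0"
      using anorm_smult[of \<one> c] by (simp add: alg_closed anorm_zero)
    then show False using m(1) c anorm_one by simp
  qed
  then have "degree m = 1" using m(2) by simp
  then obtain l where "poly m l = 0"
    using fundamental_theorem_of_algebra[of m] by (auto simp: constant_degree)
  then obtain k where k: "m = [:- l, 1:] * k"
    unfolding poly_eq_0_iff_dvd by (elim dvdE)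
  have k0: "k \<noteq> 0" using k m(1) by auto
  have "degree m = 1 + degree k"
    unfolding k by (subst degree_mult_eq) (use k0 in auto)
  then obtain c where c: "k = [:c:]" "c \<noteq> 0"
    using \<open>degree m = 1\<close> k0 by (auto elim: degree_eq_zeroE)
  then have "[:- l, 1:] = Polynomial.smult (inverse c) m"
    by (simp add: k mult_pCons_left)
  then have lin: "poly_eval A [:- l, 1:] a = \<zero>"
    using a m(3) by (simp only: poly_eval_smult scale_zero_right)
  \<comment> \<open>Otherwise the resolvent estimate would bound \<open>l - a\<close>, which is
    zero, below by a positive distance.\<close>
  have "l \<in> closure (numerical_range A a)"
  proof (rule ccontr)
    assume "l \<notin> closure (numerical_range A a)"
    then have d: "infdist l (closure (numerical_range A a)) > 0"
      using compact_convex_closure_range[OF a] by (intro infdist_pos_not_in_closed) auto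
    have "[:l, -1:] = Polynomial.smult (-1) [:- l, 1:]" by simp
    then have "poly_eval A ([:l, -1:] * 1) a = \<zero>"
      using a lin by (simp only: poly_eval_smult scale_zero_right mult_1_right)
    moreover have "\<forall>w\<in>closure (numerical_range A a).
        infdist l (closure (numerical_range A a)) \<le> cmod (l - w)"
      by (auto simp flip: dist_norm intro: infdist_le)
    ultimately have "infdist l (closure (numerical_range A a)) * anorm A (poly_eval A 1 a) \<le> 0"
      using resolvent_bounded_eval[OF a] anorm_zero unfolding resolvent_bounded_def by metis
    then show False
      using d a by (simp add: poly_eval_1 anorm_one)
  qed
  then have le: "cmod (poly p l) \<le> range_sup A a p"
    by (rule poly_le_range_sup[OF a])
  have "[:- l, 1:] dvd p - [:poly p l:]"
    by (simp add: poly_eq_0_iff_dvd[symmetric])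
  then obtain q where "p - [:poly p l:] = [:- l, 1:] * q" ..
  then have "p = Polynomial.smult (poly p l) 1 + [:- l, 1:] * q"
    by (simp add: algebra_simps)
  then have "poly_eval A p a = poly p l \<odot> \<one> \<oplus> \<zero>"
    using a lin by (metis poly_eval_add poly_eval_smult poly_eval_1 poly_eval_mult alg_unit(4)
        poly_eval_closed)
  then show ?thesis
    using le anorm_smult[of \<one> "poly p l"] by (simp add: alg_closed alg_unit anorm_one)
qed

section \<open>Minimal polynomial and algebraic degree\<close>

lemma minimal_poly_ex1:
  assumes a: "a \<in> carrier A" and "algebraic_elem A a"
  shows "\<exists>!m. lead_coeff m = 1 \<and> (\<forall>p. poly_eval A p a = \<zero> \<longleftrightarrow> m dvd p)"
proof -
  define P where "P = (\<lambda>p. p \<noteq> 0 \<and> poly_eval A p a = \<zero>)"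
  obtain k where k: "P k" "\<And>p. P p \<Longrightarrow> degree k \<le> degree p"
    using assms(2) ex_has_least_nat[of P _ degree] unfolding algebraic_elem_def P_def by blast
  define m where "m = Polynomial.smult (inverse (lead_coeff k)) k"
  have lead: "lead_coeff m = 1" and deg: "degree m = degree k"
    using k(1) by (auto simp: m_def P_def)
  have "m \<noteq> 0" using lead by auto
  have zero: "poly_eval A m a = \<zero>"
    using a k(1) by (simp add: m_def P_def poly_eval_smult scale_zero_right)
  have "poly_eval A p a = \<zero> \<longleftrightarrow> m dvd p" for p
  proof
    assume p: "poly_eval A p a = \<zero>"
    have "p mod m = p + Polynomial.smult (-1) (p div m) * m"
      by (simp add: minus_div_mult_eq_mod)
    then have "poly_eval A (p mod m) a = \<zero>"
      using a p zero by (simp only: poly_eval_add poly_eval_mult alg_unit poly_eval_closed alg_closed)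
    moreover have "p mod m = 0 \<or> degree (p mod m) < degree k"
      using degree_mod_less[of m p] deg \<open>m \<noteq> 0\<close> by auto
    ultimately have "p mod m = 0"
      using k(2)[of "p mod m"] unfolding P_def by force
    then show "m dvd p" by (simp add: dvd_eq_mod_eq_0)
  next
    assume "m dvd p"
    then obtain q where "p = m * q" ..
    then show "poly_eval A p a = \<zero>"
      using a zero by (simp only: poly_eval_mult alg_unit poly_eval_closed)
  qed
  with lead have m: "lead_coeff m = 1 \<and> (\<forall>p. poly_eval A p a = \<zero> \<longleftrightarrow> m dvd p)" by blast
  show ?thesis
  proof (rule ex1I[of _ m])
    show "lead_coeff m = 1 \<and> (\<forall>p. poly_eval A p a = \<zero> \<longleftrightarrow> m dvd p)" by (rule m)
    fix n assume n: "lead_coeff n = 1 \<and> (\<forall>p. poly_eval A p a = \<zero> \<longleftrightarrow> n dvd p)"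
    with m have "m dvd n" "n dvd m" by (metis dvd_refl)+
    moreover have "n \<noteq> 0" "m \<noteq> 0" using n m by auto
    moreover obtain k where k: "n = m * k" using calculation(1) ..
    ultimately have "degree m + degree k \<le> degree m" "k \<noteq> 0"
      using dvd_imp_degree_le[of n m] degree_mult_eq[of m k] by auto
    then obtain c where "k = [:c:]" by (auto elim: degree_eq_zeroE)
    moreover have "lead_coeff n = lead_coeff m * lead_coeff k"
      by (simp add: k lead_coeff_mult)
    ultimately have "k = 1" using n m by (simp add: one_pCons)
    then show "n = m" using k by simp
  qed
qed

lemma minimal_poly:
  assumes "a \<in> carrier A" "algebraic_elem A a"
  shows "lead_coeff (minimal_poly A a) = 1"
    and "poly_eval A p a = \<zero> \<longleftrightarrow> minimal_poly A a dvd p"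
  using theI'[OF minimal_poly_ex1[OF assms]] unfolding minimal_poly_def by blast+

lemma algebraic_degree_leI:
  assumes a: "a \<in> carrier A" and "m \<noteq> 0" "degree m \<le> n" "poly_eval A m a = \<zero>"
  shows "algebraic_degree_le A a n"
proof -
  have alg: "algebraic_elem A a" using assms by (auto simp: algebraic_elem_def)
  then have "minimal_poly A a dvd m" using minimal_poly(2)[OF a] assms by blast
  then have "degree (minimal_poly A a) \<le> degree m" using assms by (intro dvd_imp_degree_le) auto
  with alg assms show ?thesis by (simp add: algebraic_degree_le_def algebraic_degree_def)
qed

lemma algebraic_degree_leD:
  assumes "a \<in> carrier A" "algebraic_degree_le A a n"
  obtains m where "lead_coeff m = 1" "degree m \<le> n" "\<And>p. poly_eval A p a = \<zero> \<longleftrightarrow> m dvd p"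
  using assms minimal_poly[of a] unfolding algebraic_degree_le_def algebraic_degree_def by blast

end

section \<open>Quotients of the polynomial ring\<close>

text \<open>The null space of \<open>S\<close> is exactly the ideal generated by \<open>m\<close>,
  so \<open>S\<close> induces a norm on the quotient and not merely a seminorm.\<close>

locale poly_algebra_norm =
  fixes S :: "complex poly \<Rightarrow> real" and m :: "complex poly"
  assumes seminorm: "poly_seminorm S"
    and submult: "S (p * q) \<le> S p * S q"
    and norm_one: "S 1 = 1"
    and null_iff: "S p = 0 \<longleftrightarrow> m dvd p"
    and m_nonzero: "m \<noteq> 0"
begin

text \<open>A residue class is stored as the coefficient sequence of its remainder. This puts the
  quotient into the type \<open>nat \<Rightarrow> complex\<close> over which
  \<open>Gamma_const\<close> is formed.\<close>

definition enc :: "complex poly \<Rightarrow> nat \<Rightarrow> complex" where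
  "enc p = coeff (p mod m)"

definition dec :: "(nat \<Rightarrow> complex) \<Rightarrow> complex poly" where
  "dec = Abs_poly"

definition quot_alg :: "(nat \<Rightarrow> complex) normed_alg" where
  "quot_alg = \<lparr>carrier = range enc, mult = (\<lambda>x y. enc (dec x * dec y)), one = enc 1,
     zero = enc 0, add = (\<lambda>x y. enc (dec x + dec y)),
     smult = (\<lambda>c x. enc (Polynomial.smult c (dec x))), anorm = (\<lambda>x. S (dec x))\<rparr>"

lemma dec_enc: "dec (enc p) = p mod m"
  by (simp add: dec_def enc_def coeff_inverse)

lemma enc_eq_iff: "enc p = enc q \<longleftrightarrow> p mod m = q mod m"
  by (simp add: enc_def coeff_inject)

lemma norm_mod: "S (p mod m) = S p"
proof (rule poly_seminorm_eq_mod[OF seminorm])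
  have "m dvd p mod m - p"
    by (simp add: mod_eq_dvd_iff[symmetric] mod_eq_dvd_iff_nat flip: mod_eq_dvd_iff)
  then show "S (p mod m - p) = 0" by (simp add: null_iff)
qed

lemma quot_alg_simps:
  "carrier quot_alg = range enc" "\<one>\<^bsub>quot_alg\<^esub> = enc 1" "\<zero>\<^bsub>quot_alg\<^esub> = enc 0"
  "enc p \<otimes>\<^bsub>quot_alg\<^esub> enc q = enc (p * q)" "enc p \<oplus>\<^bsub>quot_alg\<^esub> enc q = enc (p + q)"
  "c \<odot>\<^bsub>quot_alg\<^esub> enc p = enc (Polynomial.smult c p)" "anorm quot_alg (enc p) = S p"
  by (simp_all add: quot_alg_def dec_enc norm_mod enc_eq_iff mod_mult_eq mod_add_eq mod_smult_left)

lemma quot_alg_cases: "x \<in> carrier quot_alg \<Longrightarrow> (\<And>p. x = enc p \<Longrightarrow> thesis) \<Longrightarrow> thesis"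
  by (auto simp: quot_alg_simps)

lemma abelian_group_quot: "abelian_group quot_alg"
proof (rule abelian_groupI)
  show "\<exists>y\<in>carrier quot_alg. y \<oplus>\<^bsub>quot_alg\<^esub> x = \<zero>\<^bsub>quot_alg\<^esub>" if x: "x \<in> carrier quot_alg" for x
  proof -
    obtain p where "x = enc p" using x by (rule quot_alg_cases)
    then have "enc (- p) \<oplus>\<^bsub>quot_alg\<^esub> x = \<zero>\<^bsub>quot_alg\<^esub>" by (simp add: quot_alg_simps)
    then show ?thesis by (auto simp: quot_alg_simps)
  qed
qed (auto elim!: quot_alg_cases simp: quot_alg_simps algebra_simps)

lemma ring_quot: "ring quot_alg"
proof (rule ringI[OF abelian_group_quot])
  show "monoid quot_alg"
    by (rule monoidI) (auto elim!: quot_alg_cases simp: quot_alg_simps algebra_simps)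
qed (auto elim!: quot_alg_cases simp: quot_alg_simps algebra_simps)

lemma module_quot: "module complex_ring quot_alg"
  by (rule moduleI[OF cring_complex_ring abelian_group_quot])
    (auto elim!: quot_alg_cases simp: quot_alg_simps complex_ring_def smult_add_left smult_add_right)

sublocale quot: unital_normed_algebra quot_alg
proof (rule unital_normed_algebra.intro[OF ring_quot module_quot], unfold_locales)
  show "anorm quot_alg x = 0 \<longleftrightarrow> x = \<zero>\<^bsub>quot_alg\<^esub>" if "x \<in> carrier quot_alg" for x
    using that by (auto elim!: quot_alg_cases simp: quot_alg_simps null_iff enc_eq_iff dvd_eq_mod_eq_0)
qed (auto elim!: quot_alg_cases simp: quot_alg_simps poly_seminorm_nonneg[OF seminorm] submult
    norm_one poly_seminorm_smult[OF seminorm] poly_seminorm_add[OF seminorm])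

lemma enc_closed [simp]: "enc p \<in> carrier quot_alg"
  by (simp add: quot_alg_simps)

lemma poly_eval_quot: "poly_eval quot_alg p (enc [:0, 1:]) = enc p"
proof (induction p)
  case 0
  then show ?case by (simp add: quot.poly_eval_0 quot_alg_simps)
next
  case (pCons c p)
  then show ?case by (simp add: quot.poly_eval_pCons) (simp add: quot_alg_simps mult_pCons_left)
qed

lemma algebraic_quot: "degree m \<le> n \<Longrightarrow> algebraic_degree_le quot_alg (enc [:0, 1:]) n"
  using m_nonzero
  by (intro quot.algebraic_degree_leI[of _ m])
    (simp_all add: poly_eval_quot quot_alg_simps enc_eq_iff)

lemma adist_quot: "adist quot_alg (enc p) (enc q) = S (p - q)"
proof -
  have "\<ominus>\<^bsub>quot_alg\<^esub> enc q = enc (- q)"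
    using quot.scale_minus_one[of "enc q"] by (simp add: quot_alg_simps)
  then show ?thesis by (simp add: adist_def a_minus_def quot_alg_simps)
qed

lemma Metric_space_quot: "Metric_space (carrier quot_alg) (adist quot_alg)"
proof
  show "0 \<le> adist quot_alg x y" for x y
    by (auto simp: adist_def intro!: quot.anorm_nonneg ring.ring_simprules(4)[OF ring_quot])
  show "adist quot_alg x y = adist quot_alg y x" for x y
  proof (cases "x \<in> carrier quot_alg \<and> y \<in> carrier quot_alg")
    case True
    then show ?thesis
      using poly_seminorm_minus[OF seminorm] by (metis adist_quot minus_diff_eq quot_alg_cases)
  qed (auto simp: adist_def)
  show "adist quot_alg x y = 0 \<longleftrightarrow> x = y" if "x \<in> carrier quot_alg" "y \<in> carrier quot_alg" for x y
    using that by (auto elim!: quot_alg_cases simp: adist_quot null_iff enc_eq_iff mod_eq_dvd_iff)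
  show "adist quot_alg x z \<le> adist quot_alg x y + adist quot_alg y z"
    if "x \<in> carrier quot_alg" "y \<in> carrier quot_alg" "z \<in> carrier quot_alg" for x y z
    using that poly_seminorm_add[OF seminorm]
    by (auto elim!: quot_alg_cases simp: adist_quot) (metis diff_add_cancel add_diff_eq)
qed

section \<open>Completeness of the quotient\<close>

definition of_coeffs :: "(nat \<Rightarrow> complex) \<Rightarrow> complex poly" where
  "of_coeffs x = (\<Sum>i<degree m. monom (x i) i)"

lemma coeff_of_coeffs: "coeff (of_coeffs x) i = (if i < degree m then x i else 0)"
  by (simp add: of_coeffs_def coeff_sum)

lemma of_coeffs_coeff: "degree p < degree m \<Longrightarrow> of_coeffs (coeff p) = p"
  by (auto simp: poly_eq_iff coeff_of_coeffs coeff_eq_0)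

lemma norm_of_coeffs_le: "S (of_coeffs x) \<le> (\<Sum>i<degree m. cmod (x i) * S (monom 1 i))"
proof -
  have "S (\<Sum>i\<in>I. monom (x i) i) \<le> (\<Sum>i\<in>I. cmod (x i) * S (monom 1 i))" if "finite I" for I
    using that
  proof induction
    case empty
    then show ?case by (simp add: poly_seminorm_0[OF seminorm])
  next
    case (insert j I)
    have "S (monom (x j) j) = cmod (x j) * S (monom 1 j)"
      using poly_seminorm_smult[OF seminorm, of "x j" "monom 1 j"] by (simp add: smult_monom)
    with insert show ?case
      using poly_seminorm_add[OF seminorm, of "monom (x j) j" "\<Sum>i\<in>I. monom (x i) i"] by simp
  qed
  then show ?thesis by (simp add: of_coeffs_def)
qed

lemma of_coeffs_diff: "of_coeffs x - of_coeffs y = of_coeffs (\<lambda>i. x i - y i)"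
  by (simp add: poly_eq_iff coeff_of_coeffs)

lemma continuous_norm_of_coeffs: "continuous_on UNIV (\<lambda>x. S (of_coeffs x))"
  unfolding continuous_on_def
proof
  fix x :: "nat \<Rightarrow> complex"
  have "((\<lambda>y. S (of_coeffs y) - S (of_coeffs x)) \<longlongrightarrow> 0) (at x)"
  proof (rule Lim_null_comparison)
    have "\<bar>S (of_coeffs y) - S (of_coeffs x)\<bar> \<le> (\<Sum>i<degree m. cmod (y i - x i) * S (monom 1 i))" for y
    proof -
      have 1: "S (of_coeffs y) \<le> S (of_coeffs x) + S (of_coeffs (\<lambda>i. y i - x i))"
        using poly_seminorm_add[OF seminorm, of "of_coeffs x" "of_coeffs y - of_coeffs x"]
        by (simp flip: of_coeffs_diff)
      have 2: "S (of_coeffs x) \<le> S (of_coeffs y) + S (of_coeffs (\<lambda>i. y i - x i))"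
        using poly_seminorm_diff[OF seminorm, of "of_coeffs y" "of_coeffs y - of_coeffs x"]
        by (simp flip: of_coeffs_diff)
      show ?thesis using 1 2 norm_of_coeffs_le[of "\<lambda>i. y i - x i"] by linarith
    qed
    then show "\<forall>\<^sub>F y in at x. norm (S (of_coeffs y) - S (of_coeffs x))
        \<le> (\<Sum>i<degree m. cmod (y i - x i) * S (monom 1 i))"
      by (intro always_eventually) simp
    have "((\<lambda>y. y i) \<longlongrightarrow> x i) (at x)" for i
      using continuous_on_product_coordinates[of i] by (auto simp: continuous_on_def)
    then have "((\<lambda>y. \<Sum>i<degree m. cmod (y i - x i) * S (monom 1 i))
        \<longlongrightarrow> (\<Sum>i<degree m. cmod (x i - x i) * S (monom 1 i))) (at x)"
      by (intro tendsto_intros)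
    then show "((\<lambda>y. \<Sum>i<degree m. cmod (y i - x i) * S (monom 1 i)) \<longlongrightarrow> 0) (at x)"
      by simp
  qed
  then show "((\<lambda>x. S (of_coeffs x)) \<longlongrightarrow> S (of_coeffs x)) (at x within UNIV)"
    using Lim_null by blast
qed

lemma degree_m_pos: "degree m > 0"
proof (rule ccontr)
  assume "\<not> degree m > 0"
  then have "m dvd 1" using m_nonzero by (auto simp: is_unit_iff_degree)
  then show False using norm_one null_iff[of 1] by simp
qed

text \<open>Norms on a finite-dimensional space are equivalent: \<open>S\<close> attains its minimum
  on the compact unit sphere of the coefficient sum norm, and that minimum is positive since a
  nonzero polynomial of degree below \<open>degree m\<close> is not a multiple of
  \<open>m\<close>.\<close>

lemma coeff_bound:
  obtains c where "c > 0" "\<And>p. degree p < degree m \<Longrightarrow> c * (\<Sum>i<degree m. cmod (coeff p i)) \<le> S p"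
proof -
  \<comment> \<open>Coordinates from \<open>degree m\<close> on are pinned to 0, so that Tychonoff
    makes the box compact in the function space.\<close>
  define B where "B = (\<lambda>i::nat. if i < degree m then cball (0::complex) 1 else {0})"
  define T where "T = PiE UNIV B \<inter> {x. (\<Sum>i<degree m. cmod (x i)) = 1}"
  have "compactin (product_topology (\<lambda>i. euclidean) UNIV) (PiE UNIV B)"
    by (subst compactin_PiE) (auto simp: B_def)
  then have "compact (PiE UNIV B)"
    by (simp add: euclidean_product_topology)
  moreover have "closed {x::nat \<Rightarrow> complex. (\<Sum>i<degree m. cmod (x i)) = 1}"
    by (intro closed_Collect_eq continuous_on_sum continuous_on_norm continuous_on_const)
      (rule continuous_on_product_coordinates)
  ultimately have "compact T"
    unfolding T_def by (rule compact_Int_closed)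
  moreover have "(\<lambda>i. if i = 0 then 1 else 0) \<in> T"
    using degree_m_pos by (auto simp: T_def B_def PiE_def if_distrib sum.delta cong: if_cong)
  moreover have "continuous_on T (\<lambda>x. S (of_coeffs x))"
    by (rule continuous_on_subset[OF continuous_norm_of_coeffs]) simp
  ultimately obtain x where x: "x \<in> T" "\<And>y. y \<in> T \<Longrightarrow> S (of_coeffs x) \<le> S (of_coeffs y)"
    using continuous_attains_inf[of T "\<lambda>x. S (of_coeffs x)"] by blast
  define c where "c = S (of_coeffs x)"
  have "\<exists>i<degree m. x i \<noteq> 0"
  proof (rule ccontr)
    assume "\<not> ?thesis"
    then have "(\<Sum>i<degree m. cmod (x i)) = 0" by simp
    then show False using x(1) by (simp add: T_def)
  qed
  then have nz: "of_coeffs x \<noteq> 0"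
    by (metis coeff_0 coeff_of_coeffs)
  have "degree (of_coeffs x) < degree m"
    using degree_m_pos by (intro degree_lessI) (auto simp: coeff_of_coeffs)
  then have "\<not> m dvd of_coeffs x"
    using nz dvd_imp_degree_le by fastforce
  then have "c > 0"
    using null_iff poly_seminorm_nonneg[OF seminorm, of "of_coeffs x"] by (simp add: c_def less_le)
  moreover have "c * (\<Sum>i<degree m. cmod (coeff p i)) \<le> S p" if p: "degree p < degree m" for p
  proof -
    define s where "s = (\<Sum>i<degree m. cmod (coeff p i))"
    have s0: "s \<ge> 0" by (simp add: s_def sum_nonneg)
    show ?thesis
    proof (cases "s = 0")
      case True
      then show ?thesis using poly_seminorm_nonneg[OF seminorm, of p] by (simp add: s_def)
    next
      case False
      then have s: "s > 0" using s0 by simp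
      define y where "y = (\<lambda>i. complex_of_real (1 / s) * coeff p i)"
      have "cmod (coeff p i) \<le> s" if "i < degree m" for i
        unfolding s_def using that by (intro member_le_sum) auto
      moreover have "(\<Sum>i<degree m. cmod (y i)) = (\<Sum>i<degree m. cmod (coeff p i)) / s"
        using s by (simp add: y_def norm_mult norm_divide sum_divide_distrib)
      then have "(\<Sum>i<degree m. cmod (y i)) = 1"
        using s by (simp flip: s_def)
      ultimately have "y \<in> T"
        using s p by (auto simp: T_def B_def y_def PiE_def norm_divide coeff_eq_0)
      then have "c \<le> S (of_coeffs y)" unfolding c_def by (rule x(2))
      also have "of_coeffs y = Polynomial.smult (complex_of_real (1 / s)) p"
        using p by (auto simp: poly_eq_iff coeff_of_coeffs y_def coeff_eq_0)
      also have "S \<dots> = S p / s"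
        using s by (subst poly_seminorm_smult[OF seminorm]) (simp add: norm_divide)
      finally show ?thesis using s by (simp add: field_simps flip: s_def)
    qed
  qed
  ultimately show ?thesis using that by blast
qed

text \<open>By \<open>coeff_bound\<close> the coefficients of a Cauchy sequence are Cauchy;
  \<open>norm_of_coeffs_le\<close> turns their limits back into a limit for
  \<open>S\<close>.\<close>

theorem unital_banach_algebra_quot: "unital_banach_algebra quot_alg"
proof (rule unital_banach_algebra.intro[OF quot.unital_normed_algebra_axioms], unfold_locales)
  interpret M: Metric_space "carrier quot_alg" "adist quot_alg" by (rule Metric_space_quot)
  obtain c where c: "c > 0"
      "\<And>p. degree p < degree m \<Longrightarrow> c * (\<Sum>i<degree m. cmod (coeff p i)) \<le> S p"
    by (rule coeff_bound) blast
  show "M.mcomplete"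
    unfolding M.mcomplete_def
  proof (intro allI impI)
    fix \<sigma> :: "nat \<Rightarrow> nat \<Rightarrow> complex"
    assume \<sigma>: "M.MCauchy \<sigma>"
    define q where "q = (\<lambda>n. dec (\<sigma> n))"
    have q: "\<sigma> n = enc (q n)" "degree (q n) < degree m" for n
    proof -
      have "\<sigma> n \<in> carrier quot_alg"
        using \<sigma> unfolding M.MCauchy_def by blast
      then obtain p where p: "\<sigma> n = enc p" by (rule quot_alg_cases)
      then show "\<sigma> n = enc (q n)" by (simp add: q_def dec_enc enc_eq_iff)
      show "degree (q n) < degree m"
        using p degree_mod_less_degree[of m p] m_nonzero degree_m_pos degree_mod_less[of m p]
        by (auto simp: q_def dec_enc)
    qed
    have Cau: "Cauchy (\<lambda>n. coeff (q n) i)" if i: "i < degree m" for i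
    proof (rule CauchyI)
      fix e :: real assume "e > 0"
      then have "c * e > 0" using c by simp
      then obtain N where N: "\<And>n n'. N \<le> n \<Longrightarrow> N \<le> n' \<Longrightarrow> adist quot_alg (\<sigma> n) (\<sigma> n') < c * e"
        using \<sigma> unfolding M.MCauchy_def by metis
      have "cmod (coeff (q n) i - coeff (q n') i) < e" if "N \<le> n" "N \<le> n'" for n n'
      proof -
        have "c * cmod (coeff (q n - q n') i) \<le> c * (\<Sum>j<degree m. cmod (coeff (q n - q n') j))"
          using c i by (intro mult_left_mono member_le_sum) auto
        also have "\<dots> \<le> S (q n - q n')"
          using q by (intro c degree_diff_less) auto
        also have "\<dots> < c * e"
          using N[OF that] by (simp add: q(1) adist_quot)
        finally show ?thesis using c by simp
      qed
      then show "\<exists>M. \<forall>m\<ge>M. \<forall>n\<ge>M. norm (coeff (q m) i - coeff (q n) i) < e" by blast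
    qed
    define l where "l = (\<lambda>i. lim (\<lambda>n. coeff (q n) i))"
    have l: "(\<lambda>n. coeff (q n) i) \<longlonglongrightarrow> l i" if "i < degree m" for i
      unfolding l_def using Cau[OF that] by (simp add: Cauchy_convergent convergent_LIMSEQ_iff[symmetric])
    have "(\<lambda>n. S (q n - of_coeffs l)) \<longlonglongrightarrow> 0"
    proof (rule tendsto_sandwich[OF _ _ tendsto_const])
      show "\<forall>\<^sub>F n in sequentially. 0 \<le> S (q n - of_coeffs l)"
        by (intro always_eventually allI poly_seminorm_nonneg[OF seminorm])
      have "S (q n - of_coeffs l) \<le> (\<Sum>i<degree m. cmod (coeff (q n) i - l i) * S (monom 1 i))" for n
        using norm_of_coeffs_le[of "\<lambda>i. coeff (q n) i - l i"] of_coeffs_coeff[OF q(2)[of n]]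
        by (simp flip: of_coeffs_diff)
      then show "\<forall>\<^sub>F n in sequentially. S (q n - of_coeffs l)
          \<le> (\<Sum>i<degree m. cmod (coeff (q n) i - l i) * S (monom 1 i))"
        by (intro always_eventually allI)
      have "(\<lambda>n. \<Sum>i<degree m. cmod (coeff (q n) i - l i) * S (monom 1 i))
          \<longlonglongrightarrow> (\<Sum>i<degree m. cmod (l i - l i) * S (monom 1 i))"
        by (intro tendsto_intros l) simp
      then show "(\<lambda>n. \<Sum>i<degree m. cmod (coeff (q n) i - l i) * S (monom 1 i)) \<longlonglongrightarrow> 0"
        by simp
    qed
    then have "limitin M.mtopology \<sigma> (enc (of_coeffs l)) sequentially"
      by (simp add: M.limitin_metric_dist_null q(1) adist_quot)
    then show "\<exists>x. limitin M.mtopology \<sigma> x sequentially" by blast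
  qed
qed

end

section \<open>Comparison of an algebra with the quotient by a minimal polynomial\<close>

context unital_normed_algebra
begin

lemma poly_algebra_norm_eval:
  assumes a: "a \<in> carrier A" and m: "m \<noteq> 0" "\<And>p. poly_eval A p a = \<zero> \<longleftrightarrow> m dvd p"
  shows "poly_algebra_norm (\<lambda>p. anorm A (poly_eval A p a)) m"
proof
  show "poly_seminorm (\<lambda>p. anorm A (poly_eval A p a))" by (rule poly_seminorm_eval[OF a])
  show "anorm A (poly_eval A (p * q) a) \<le> anorm A (poly_eval A p a) * anorm A (poly_eval A q a)" for p q
    using a by (simp add: poly_eval_mult anorm_mult)
  show "anorm A (poly_eval A 1 a) = 1"
    using a by (simp add: poly_eval_1 anorm_one)
  show "anorm A (poly_eval A p a) = 0 \<longleftrightarrow> m dvd p" for p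
    using a m by (simp add: anorm_eq_0)
  show "m \<noteq> 0" by (rule m)
qed

text \<open>States on the subalgebra of polynomials in \<open>a\<close> extend to \<open>A\<close>.\<close>

lemma numerical_range_quot_subset:
  assumes a: "a \<in> carrier A" and m: "m \<noteq> 0" "\<And>p. poly_eval A p a = \<zero> \<longleftrightarrow> m dvd p"
  shows "numerical_range (poly_algebra_norm.quot_alg (\<lambda>p. anorm A (poly_eval A p a)) m)
      (poly_algebra_norm.enc m [:0, 1:]) \<subseteq> numerical_range A a"
proof
  interpret Q: poly_algebra_norm "\<lambda>p. anorm A (poly_eval A p a)" m
    by (rule poly_algebra_norm_eval[OF assms])
  fix z assume "z \<in> numerical_range Q.quot_alg (Q.enc [:0, 1:])"
  then obtain \<phi> where \<phi>: "Q.quot.contractive_functional \<phi>" "\<phi> (Q.enc 1) = 1"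
      "z = \<phi> (Q.enc [:0, 1:])"
    by (auto simp: Q.quot.numerical_range_iff Q.quot_alg_simps)
  define \<psi> where "\<psi> = (\<lambda>p. \<phi> (Q.enc p))"
  have add: "\<psi> (p + q) = \<psi> p + \<psi> q" for p q
    using \<phi>(1) Q.enc_closed Q.quot_alg_simps(5)[of p q]
    unfolding \<psi>_def Q.quot.contractive_functional_def by metis
  have scale: "\<psi> (Polynomial.smult c p) = c * \<psi> p" for c p
    using \<phi>(1) Q.enc_closed Q.quot_alg_simps(6)[of c p]
    unfolding \<psi>_def Q.quot.contractive_functional_def by metis
  have bound: "cmod (\<psi> p) \<le> anorm A (poly_eval A p a)" for p
    using \<phi>(1) Q.enc_closed Q.quot_alg_simps(7)[of p]
    unfolding \<psi>_def Q.quot.contractive_functional_def by metis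
  \<comment> \<open>The graph of \<open>- Re \<psi>\<close> over a whole subspace: constraints at
    \<open>p\<close> and \<open>- p\<close> together force equality of real parts.\<close>
  define G where "G = range (\<lambda>p. (poly_eval A p a, - Re (\<psi> p)))"
  have "real_cone G"
    unfolding real_cone_def
  proof (intro conjI allI impI)
    have "\<psi> 0 = 0" using scale[of 0 0] by simp
    then show "(\<zero>, 0) \<in> G"
      unfolding G_def using a by (intro range_eqI[of _ _ 0]) (simp add: poly_eval_0)
  next
    fix v r w s assume "(v, r) \<in> G" "(w, s) \<in> G"
    then obtain p q where "v = poly_eval A p a" "r = - Re (\<psi> p)" "w = poly_eval A q a" "s = - Re (\<psi> q)"
      by (auto simp: G_def)
    then show "(v \<oplus> w, r + s) \<in> G"
      unfolding G_def using a by (intro range_eqI[of _ _ "p + q"]) (simp add: poly_eval_add add)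
  next
    fix t v r assume "(v, r) \<in> G"
    then obtain p where "v = poly_eval A p a" "r = - Re (\<psi> p)"
      by (auto simp: G_def)
    then show "(complex_of_real t \<odot> v, t * r) \<in> G"
      unfolding G_def using a
      by (intro range_eqI[of _ _ "Polynomial.smult (complex_of_real t) p"])
        (simp add: poly_eval_smult scale)
  qed (use a in \<open>auto simp: G_def\<close>)
  moreover have "0 \<le> anorm A v + r" if "(v, r) \<in> G" for v r
    using that bound complex_Re_le_cmod order_trans by (fastforce simp: G_def)
  ultimately obtain f where f: "contractive_functional f" "\<And>v r. (v, r) \<in> G \<Longrightarrow> - r \<le> Re (f v)"
    using hahn_banach_cone by blast
  have ge: "Re (\<psi> p) \<le> Re (f (poly_eval A p a))" for p
    using f(2)[of "poly_eval A p a" "- Re (\<psi> p)"] by (simp add: G_def)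
  have f_scale: "f (poly_eval A (Polynomial.smult c p) a) = c * f (poly_eval A p a)" for c p
    using f(1) a by (simp add: contractive_functional_def poly_eval_smult)
  have eq: "f (poly_eval A p a) = \<psi> p" for p
  proof -
    \<comment> \<open>The real parts at \<open>p\<close> and at \<open>i p\<close> determine the
      complex values.\<close>
    have re: "Re (\<psi> p) = Re (f (poly_eval A p a))" for p
      using ge[of p] ge[of "Polynomial.smult (- 1) p"] by (simp only: f_scale scale) simp
    show ?thesis
      using re[of p] re[of "Polynomial.smult \<i> p"]
      by (simp only: f_scale scale) (simp add: complex_eq_iff)
  qed
  have "f \<one> = 1" "z = f a"
    using eq[of 1] eq[of "[:0, 1:]"] \<phi> a by (simp_all add: poly_eval_1 poly_eval_X \<psi>_def)
  then show "z \<in> numerical_range A a"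
    using f(1) by (auto simp: numerical_range_iff)
qed

lemma spectral_constant_le:
  assumes a: "a \<in> carrier A" and "\<And>p. anorm A (poly_eval A p a) \<le> C * range_sup A a p"
  shows "spectral_constant A a \<le> ereal C"
  unfolding spectral_constant_def
  using assms(2) by (intro SUP_least) (simp add: pos_divide_le_eq)

text \<open>Numerators agree and the numerical range of the quotient is contained in that of
  \<open>a\<close>, so each ratio can only increase on passing to the quotient.\<close>

lemma spectral_constant_quot_le:
  assumes a: "a \<in> carrier A" and m: "m \<noteq> 0" "\<And>p. poly_eval A p a = \<zero> \<longleftrightarrow> m dvd p"
    and G: "spectral_constant (poly_algebra_norm.quot_alg (\<lambda>p. anorm A (poly_eval A p a)) m)
      (poly_algebra_norm.enc m [:0, 1:]) \<le> G" "0 \<le> G"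
  shows "spectral_constant A a \<le> G"
proof -
  interpret Q: poly_algebra_norm "\<lambda>p. anorm A (poly_eval A p a)" m
    by (rule poly_algebra_norm_eval[OF a m])
  define x where "x = Q.enc [:0, 1:]"
  have x: "x \<in> carrier Q.quot_alg" by (simp add: x_def)
  have eval: "anorm Q.quot_alg (poly_eval Q.quot_alg p x) = anorm A (poly_eval A p a)" for p
    by (simp add: x_def Q.poly_eval_quot Q.quot_alg_simps)
  have le: "range_sup Q.quot_alg x p \<le> range_sup A a p" for p
    unfolding range_sup_def x_def
    by (intro cSUP_subset_mono Q.quot.numerical_range_nonempty range_sup_bdd[OF a]
        numerical_range_quot_subset[OF a m] order_refl)
  show ?thesis
    unfolding spectral_constant_def
  proof (rule SUP_least)
    fix p assume "p \<in> {p. 0 < range_sup A a p}"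
    then have pos: "0 < range_sup A a p" by simp
    show "ereal (anorm A (poly_eval A p a) / range_sup A a p) \<le> G"
    proof (cases "range_sup Q.quot_alg x p > 0")
      case True
      have "anorm A (poly_eval A p a) / range_sup A a p
          \<le> anorm A (poly_eval A p a) / range_sup Q.quot_alg x p"
        using True pos le a by (intro divide_left_mono anorm_nonneg) auto
      then have "ereal (anorm A (poly_eval A p a) / range_sup A a p)
          \<le> ereal (anorm A (poly_eval A p a) / range_sup Q.quot_alg x p)"
        by simp
      also have "\<dots> = ereal (anorm Q.quot_alg (poly_eval Q.quot_alg p x) / range_sup Q.quot_alg x p)"
        by (simp only: eval)
      also have "\<dots> \<le> spectral_constant Q.quot_alg x"
        unfolding spectral_constant_def using True by (intro SUP_upper) simp
      finally show ?thesis using G by (simp add: x_def)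
    next
      \<comment> \<open>Such a \<open>p\<close> is excluded from the supremum over the quotient; the
        uniform bound already proved shows that \<open>p(a)\<close> is zero.\<close>
      case False
      then have "range_sup Q.quot_alg x p = 0"
        using Q.quot.range_sup_nonneg[OF x, of p] by simp
      moreover have "poly_eval Q.quot_alg m x = \<zero>\<^bsub>Q.quot_alg\<^esub>"
        by (simp add: x_def Q.poly_eval_quot Q.quot_alg_simps Q.enc_eq_iff)
      ultimately have "anorm A (poly_eval A p a) \<le> 0"
        using Q.quot.poly_eval_bound[OF x m(1) order_refl, of p] by (simp add: eval)
      then have "anorm A (poly_eval A p a) = 0"
        using anorm_nonneg a by (simp add: order_antisym)
      then show ?thesis using G(2) by (simp add: zero_ereal_def)
    qed
  qed
qed

end

section \<open>Annihilating polynomials of matrices\<close>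

text \<open>Any degree bound that depends on the number of functionals alone suffices here.\<close>

lemma common_kernel_poly:
  fixes g :: "nat \<Rightarrow> complex poly \<Rightarrow> complex"
  assumes "\<And>i p q. i < k \<Longrightarrow> g i (p + q) = g i p + g i q"
    and "\<And>i c p. i < k \<Longrightarrow> g i (Polynomial.smult c p) = c * g i p"
  shows "\<exists>p. p \<noteq> 0 \<and> degree p < 2 ^ k \<and> (\<forall>i<k. g i p = 0)"
  using assms
proof (induction k arbitrary: g)
  case 0
  show ?case by (rule exI[of _ 1]) simp
next
  case (Suc k)
  have "\<exists>p. p \<noteq> 0 \<and> degree p < 2 ^ k \<and> (\<forall>i<k. g i p = 0)"
    by (rule Suc.IH) (simp_all add: Suc.prems)
  then obtain p where p: "p \<noteq> 0" "degree p < 2 ^ k" "\<forall>i<k. g i p = 0"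
    by blast
  \<comment> \<open>The second solution has only degrees from \<open>2 ^ k\<close> on, above those
    of \<open>p\<close>. The combination \<open>r\<close> that kills \<open>g k\<close> therefore
    keeps the degree of \<open>Q\<close> and is nonzero.\<close>
  have "\<exists>q. q \<noteq> 0 \<and> degree q < 2 ^ k \<and> (\<forall>i<k. g i (monom 1 (2 ^ k) * q) = 0)"
    by (rule Suc.IH) (simp_all add: Suc.prems distrib_left)
  then obtain q where q: "q \<noteq> 0" "degree q < 2 ^ k" "\<forall>i<k. g i (monom 1 (2 ^ k) * q) = 0"
    by blast
  define Q where "Q = monom 1 (2 ^ k) * q"
  have dQ: "degree Q = 2 ^ k + degree q"
    unfolding Q_def using q(1) by (subst degree_mult_eq) (simp_all add: degree_monom_eq)
  show ?case
  proof (cases "g k p = 0")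
    case True
    then show ?thesis using p by (intro exI[of _ p]) (auto simp: less_Suc_eq)
  next
    case False
    define r where "r = Polynomial.smult (g k Q) p + Polynomial.smult (- g k p) Q"
    have d1: "degree (Polynomial.smult (g k Q) p) < 2 ^ k"
      using p(2) degree_smult_le[of "g k Q" p] by simp
    have d2: "degree (Polynomial.smult (- g k p) Q) = 2 ^ k + degree q"
      using False dQ by simp
    have dr: "degree r = 2 ^ k + degree q"
      unfolding r_def using d1 d2 by (subst degree_add_eq_right) auto
    have "g i r = 0" if "i < Suc k" for i
    proof -
      have "g i r = g k Q * g i p + (- g k p) * g i Q"
        unfolding r_def by (simp only: Suc.prems[OF that])
      then show ?thesis
        using that p(3) q(3) by (cases "i = k") (auto simp flip: Q_def)
    qed
    moreover have "r \<noteq> 0" using dr by (metis degree_0 add_is_0 power_not_zero zero_neq_numeral)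
    moreover have "degree r < 2 ^ Suc k" using dr q(2) by simp
    ultimately show ?thesis by blast
  qed
qed

text \<open>Each of the \<open>d * d\<close> entries of \<open>p(a)\<close> is linear in
  \<open>p\<close>, so a common kernel element is a polynomial with \<open>p(a) = 0\<close>.\<close>

lemma matrix_annihilating_poly:
  assumes A: "unital_normed_algebra (matrix_alg d N)" and a: "a \<in> carrier_mat d d"
  obtains m where "m \<noteq> 0" "degree m \<le> 2 ^ (d * d)"
    "poly_eval (matrix_alg d N) m a = \<zero>\<^bsub>matrix_alg d N\<^esub>"
proof -
  interpret unital_normed_algebra "matrix_alg d N" by (rule A)
  have a': "a \<in> carrier (matrix_alg d N)" using a by (simp add: matrix_alg_def)
  define E where "E = (\<lambda>p. poly_eval (matrix_alg d N) p a)"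
  have E: "E p \<in> carrier_mat d d" for p
    using poly_eval_closed[OF a'] by (simp add: E_def matrix_alg_def)
  have E_add: "E (p + q) = E p + E q" for p q
    using poly_eval_add[OF a'] by (simp add: E_def matrix_alg_def)
  have E_smult: "E (Polynomial.smult c p) = c \<cdot>\<^sub>m E p" for c p
    using poly_eval_smult[OF a'] by (simp add: E_def matrix_alg_def)
  have idx: "i div d < d" "i mod d < d" if "i < d * d" for i
    using that by (auto simp: less_mult_imp_div_less intro!: mod_less_divisor gr0I)
  have "\<exists>m. m \<noteq> 0 \<and> degree m < 2 ^ (d * d) \<and> (\<forall>i<d * d. E m $$ (i div d, i mod d) = 0)"
  proof (rule common_kernel_poly)
    fix i p q c assume i: "i < d * d"
    show "E (p + q) $$ (i div d, i mod d) = E p $$ (i div d, i mod d) + E q $$ (i div d, i mod d)"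
      using E[of p] E[of q] idx[OF i] by (simp add: E_add carrier_matD)
    show "E (Polynomial.smult c p) $$ (i div d, i mod d) = c * E p $$ (i div d, i mod d)"
      using E[of p] idx[OF i] by (simp add: E_smult carrier_matD)
  qed
  then obtain m where m: "m \<noteq> 0" "degree m < 2 ^ (d * d)"
      "\<forall>i<d * d. E m $$ (i div d, i mod d) = 0"
    by blast
  have "E m = 0\<^sub>m d d"
  proof (rule eq_matI)
    fix i j assume "i < dim_row (0\<^sub>m d d)" "j < dim_col (0\<^sub>m d d)"
    then have ij: "i < d" "j < d" by auto
    have "i * d + j < d * d"
    proof -
      have "i * d + j < Suc i * d" using ij by simp
      also have "\<dots> \<le> d * d" using ij by (intro mult_le_mono1) simp
      finally show ?thesis .
    qed
    moreover have "(i * d + j) div d = i" "(i * d + j) mod d = j" using ij by auto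
    ultimately show "E m $$ (i, j) = 0\<^sub>m d d $$ (i, j)" using m(3) ij by force
  qed (use E in auto)
  then show ?thesis
    using m that by (simp add: E_def matrix_alg_def)
qed

section \<open>The lower bound\<close>

definition power_bounded_functional :: "complex poly \<Rightarrow> (complex poly \<Rightarrow> complex) \<Rightarrow> bool" where
  "power_bounded_functional m L \<longleftrightarrow> (\<forall>p q. L (p + q) = L p + L q) \<and>
     (\<forall>c p. L (Polynomial.smult c p) = c * L p) \<and> (\<forall>q. L (m * q) = 0) \<and>
     (\<forall>k. cmod (L (monom 1 k)) \<le> 1)"

text \<open>The functionals form the polar of the powers of \<open>X\<close> in the quotient by
  \<open>m\<close>, so this is the gauge of the closed absolutely convex hull of these
  powers.\<close>

definition power_bounded_norm :: "complex poly \<Rightarrow> complex poly \<Rightarrow> real" where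
  "power_bounded_norm m p = (SUP L\<in>Collect (power_bounded_functional m). cmod (L p))"

lemma power_bounded_functionalD:
  assumes "power_bounded_functional m L"
  shows "L (p + q) = L p + L q" "L (Polynomial.smult c p) = c * L p" "L (m * q) = 0"
    "cmod (L (monom 1 k)) \<le> 1"
  using assms by (simp_all add: power_bounded_functional_def)

lemma power_bounded_functional_0: "power_bounded_functional m (\<lambda>_. 0)"
  by (simp add: power_bounded_functional_def)

text \<open>Expansion of \<open>p\<close> into monomials. With \<open>q = 1\<close> it makes the
  supremum in \<open>power_bounded_norm\<close> finite.\<close>

lemma power_bounded_functional_le:
  assumes L: "power_bounded_functional m L"
    and K: "\<And>k. cmod (L (monom 1 k * q)) \<le> B"
  shows "cmod (L (p * q)) \<le> (\<Sum>i\<le>degree p. cmod (coeff p i)) * B"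
proof -
  have sum: "L (\<Sum>i\<in>I. f i) = (\<Sum>i\<in>I. L (f i))" if "finite I" for I :: "nat set" and f
    using that
  proof induction
    case empty
    show ?case using power_bounded_functionalD(2)[OF L, of 0 0] by simp
  qed (simp add: power_bounded_functionalD[OF L])
  have "p * q = (\<Sum>i\<le>degree p. Polynomial.smult (coeff p i) (monom 1 i * q))"
    by (subst poly_as_sum_of_monoms[symmetric]) (simp add: sum_distrib_right smult_monom flip: mult_smult_left)
  then have "L (p * q) = (\<Sum>i\<le>degree p. coeff p i * L (monom 1 i * q))"
    by (simp add: sum power_bounded_functionalD(2)[OF L])
  also have "cmod \<dots> \<le> (\<Sum>i\<le>degree p. cmod (coeff p i) * B)"
    by (intro sum_norm_le) (simp add: norm_mult mult_left_mono K)
  finally show ?thesis by (simp add: sum_distrib_right)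
qed

lemma power_bounded_norm_upper:
  assumes "power_bounded_functional m L"
  shows "cmod (L p) \<le> power_bounded_norm m p"
  unfolding power_bounded_norm_def
proof (rule cSUP_upper)
  show "bdd_above ((\<lambda>L. cmod (L p)) ` Collect (power_bounded_functional m))"
    using power_bounded_functional_le[of m _ 1 1 p] power_bounded_functionalD(4)
    by (intro bdd_aboveI2[where M = "(\<Sum>i\<le>degree p. cmod (coeff p i)) * 1"]) auto
qed (use assms in simp)

lemma power_bounded_norm_least:
  assumes "\<And>L. power_bounded_functional m L \<Longrightarrow> cmod (L p) \<le> B"
  shows "power_bounded_norm m p \<le> B"
  unfolding power_bounded_norm_def
  using assms power_bounded_functional_0 by (intro cSUP_least) auto

lemma power_bounded_functional_shift:
  assumes "power_bounded_functional m L"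
  shows "power_bounded_functional m (\<lambda>p. L (monom 1 k * p))"
  using assms
  by (auto simp: power_bounded_functional_def distrib_left mult_monom mult.left_commute)

lemma power_bounded_norm_nonneg: "0 \<le> power_bounded_norm m p"
  using power_bounded_norm_upper[OF power_bounded_functional_0, of m p] by simp

lemma power_bounded_norm_add:
  "power_bounded_norm m (p + q) \<le> power_bounded_norm m p + power_bounded_norm m q"
proof (rule power_bounded_norm_least)
  fix L assume L: "power_bounded_functional m L"
  have "cmod (L (p + q)) \<le> cmod (L p) + cmod (L q)"
    by (simp add: power_bounded_functionalD[OF L] norm_triangle_ineq)
  then show "cmod (L (p + q)) \<le> power_bounded_norm m p + power_bounded_norm m q"
    using power_bounded_norm_upper[OF L, of p] power_bounded_norm_upper[OF L, of q] by linarith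
qed

lemma power_bounded_norm_smult_le:
  "power_bounded_norm m (Polynomial.smult c p) \<le> cmod c * power_bounded_norm m p"
proof (rule power_bounded_norm_least)
  fix L assume L: "power_bounded_functional m L"
  show "cmod (L (Polynomial.smult c p)) \<le> cmod c * power_bounded_norm m p"
    by (simp add: power_bounded_functionalD[OF L] norm_mult mult_left_mono power_bounded_norm_upper[OF L])
qed

lemma poly_seminorm_power_bounded: "poly_seminorm (power_bounded_norm m)"
  unfolding poly_seminorm_def
proof (intro conjI allI)
  fix c p
  show "power_bounded_norm m (Polynomial.smult c p) = cmod c * power_bounded_norm m p"
  proof (cases "c = 0")
    case True
    then show ?thesis
      using power_bounded_norm_smult_le[of m 0 p] power_bounded_norm_nonneg[of m 0] by simp
  next
    case False
    have "power_bounded_norm m p \<le> cmod (inverse c) * power_bounded_norm m (Polynomial.smult c p)"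
      using power_bounded_norm_smult_le[of m "inverse c" "Polynomial.smult c p"] False by simp
    then have "cmod c * power_bounded_norm m p \<le> power_bounded_norm m (Polynomial.smult c p)"
      using False by (simp add: norm_inverse norm_divide field_simps)
    then show ?thesis using power_bounded_norm_smult_le[of m c p] by simp
  qed
qed (rule power_bounded_norm_add)

text \<open>If \<open>\<bar>L (X\<^sup>k q)\<bar> \<le> B\<close> for all \<open>k\<close>, then \<open>p \<mapsto> L (p q) / B\<close> is power bounded as well.\<close>

lemma power_bounded_norm_mult:
  "power_bounded_norm m (p * q) \<le> power_bounded_norm m p * power_bounded_norm m q"
proof (rule power_bounded_norm_least)
  fix L assume L: "power_bounded_functional m L"
  define B where "B = power_bounded_norm m q"
  have K: "cmod (L (monom 1 k * q)) \<le> B" for k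
    unfolding B_def by (rule power_bounded_norm_upper[OF power_bounded_functional_shift[OF L]])
  \<comment> \<open>Normalising by \<open>B\<close> fails for \<open>B = 0\<close>; then
    \<open>L\<close> kills all \<open>X^k q\<close>, hence \<open>p q\<close>.\<close>
  show "cmod (L (p * q)) \<le> power_bounded_norm m p * B"
  proof (cases "B = 0")
    case True
    then show ?thesis
      using power_bounded_functional_le[OF L K, of p] by simp
  next
    case False
    then have B: "B > 0" using power_bounded_norm_nonneg[of m q] by (simp add: B_def)
    have "power_bounded_functional m (\<lambda>p. L (p * q) / B)"
      unfolding power_bounded_functional_def
      using K B by (simp add: distrib_right power_bounded_functionalD[OF L] add_divide_distrib
          mult.assoc norm_divide)
    from power_bounded_norm_upper[OF this, of p] show ?thesis
      using B by (simp add: norm_divide field_simps)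
  qed
qed

lemma power_bounded_norm_X: "power_bounded_norm m (monom 1 k) \<le> 1"
  by (rule power_bounded_norm_least) (rule power_bounded_functionalD)

lemma power_bounded_functional_point:
  assumes "poly m z = 0" "cmod z \<le> 1"
  shows "power_bounded_functional m (\<lambda>p. poly p z)"
  using assms by (simp add: power_bounded_functional_def poly_monom norm_power power_le_one)

lemma power_bounded_norm_one:
  assumes "poly m z = 0" "cmod z \<le> 1"
  shows "power_bounded_norm m 1 = 1"
  using power_bounded_norm_upper[OF power_bounded_functional_point[OF assms], of 1]
    power_bounded_norm_X[of m 0] by (simp add: one_pCons monom_0)

section \<open>Real nodes and the alternating functional\<close>

definition node_poly :: "(nat \<Rightarrow> real) \<Rightarrow> nat \<Rightarrow> complex poly" where
  "node_poly \<mu> n = (\<Prod>j<n. [:- complex_of_real (\<mu> j), 1:])"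

lemma node_poly_root: "j < n \<Longrightarrow> poly (node_poly \<mu> n) (\<mu> j) = 0"
  by (auto simp: node_poly_def poly_prod)

lemma node_poly_nonzero: "node_poly \<mu> n \<noteq> 0"
  by (simp add: node_poly_def)

lemma degree_node_poly: "degree (node_poly \<mu> n) = n"
  unfolding node_poly_def by (subst degree_prod_eq_sum_degree) auto

lemma node_poly_dvd:
  assumes "inj_on \<mu> {..<n}" "\<And>j. j < n \<Longrightarrow> poly p (\<mu> j) = 0"
  shows "node_poly \<mu> n dvd p"
  using assms
proof (induction n arbitrary: p)
  case 0
  then show ?case by (simp add: node_poly_def)
next
  case (Suc n)
  have "[:- complex_of_real (\<mu> n), 1:] dvd p"
    using Suc.prems(2)[of n] by (simp add: poly_eq_0_iff_dvd)
  then obtain q where q: "p = [:- complex_of_real (\<mu> n), 1:] * q" ..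
  have "node_poly \<mu> n dvd q"
  proof (rule Suc.IH)
    show "inj_on \<mu> {..<n}" using Suc.prems(1) by (rule inj_on_subset) auto
    show "poly q (\<mu> j) = 0" if "j < n" for j
    proof -
      have "\<mu> j \<noteq> \<mu> n" using Suc.prems(1) that by (auto dest: inj_onD)
      then show ?thesis using Suc.prems(2)[of j] that by (auto simp: q)
    qed
  qed
  moreover have "node_poly \<mu> (Suc n) = [:- complex_of_real (\<mu> n), 1:] * node_poly \<mu> n"
    unfolding node_poly_def by (simp only: prod.lessThan_Suc mult.commute)
  ultimately show ?case
    unfolding q by (simp only: mult_dvd_mono dvd_refl)
qed

text \<open>Evaluations at the nodes are power bounded. A polynomial of norm zero thus vanishes at
  all nodes, and since these are distinct it is a multiple of \<open>node_poly\<close>.\<close>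

lemma poly_algebra_norm_node:
  assumes n: "n \<ge> 1" and \<mu>: "inj_on \<mu> {..<n}" "\<And>j. j < n \<Longrightarrow> 0 \<le> \<mu> j \<and> \<mu> j \<le> 1"
  shows "poly_algebra_norm (power_bounded_norm (node_poly \<mu> n)) (node_poly \<mu> n)"
proof
  have point: "power_bounded_functional (node_poly \<mu> n) (\<lambda>p. poly p (\<mu> j))" if "j < n" for j
    using that \<mu>(2)[OF that] by (intro power_bounded_functional_point node_poly_root) auto
  show "power_bounded_norm (node_poly \<mu> n) 1 = 1"
    using n \<mu>(2)[of 0] by (intro power_bounded_norm_one[of _ "\<mu> 0"] node_poly_root) auto
  show "power_bounded_norm (node_poly \<mu> n) p = 0 \<longleftrightarrow> node_poly \<mu> n dvd p" for p
  proof
    assume "power_bounded_norm (node_poly \<mu> n) p = 0"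
    then have "poly p (\<mu> j) = 0" if "j < n" for j
      using power_bounded_norm_upper[OF point[OF that], of p] by simp
    then show "node_poly \<mu> n dvd p" by (rule node_poly_dvd[OF \<mu>(1)])
  next
    assume "node_poly \<mu> n dvd p"
    then obtain q where q: "p = node_poly \<mu> n * q" ..
    have "power_bounded_norm (node_poly \<mu> n) p \<le> 0"
      by (rule power_bounded_norm_least) (simp add: q power_bounded_functionalD)
    then show "power_bounded_norm (node_poly \<mu> n) p = 0"
      using power_bounded_norm_nonneg[of "node_poly \<mu> n" p] by simp
  qed
qed (simp_all add: poly_seminorm_power_bounded power_bounded_norm_mult node_poly_nonzero)

definition alternating_functional :: "(nat \<Rightarrow> real) \<Rightarrow> nat \<Rightarrow> complex poly \<Rightarrow> complex" where
  "alternating_functional \<mu> n p =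
     poly p (\<mu> 0) + (\<Sum>j<n. (- 1) ^ Suc j * (poly p (\<mu> (Suc j)) - poly p (\<mu> j)))"

text \<open>On monomials the sum telescopes in absolute value because the nodes increase.\<close>

lemma power_bounded_alternating:
  assumes \<mu>: "\<And>i j. i < j \<Longrightarrow> j \<le> n \<Longrightarrow> \<mu> i < \<mu> j" "0 \<le> \<mu> 0" "\<mu> n \<le> 1"
  shows "power_bounded_functional (node_poly \<mu> (Suc n)) (alternating_functional \<mu> n)"
proof -
  have nn: "0 \<le> \<mu> j" "\<mu> j \<le> \<mu> n" if "j \<le> n" for j
  proof -
    show "0 \<le> \<mu> j" using \<mu>(1)[of 0 j] \<mu>(2) that by (cases "j = 0") auto
    show "\<mu> j \<le> \<mu> n" using \<mu>(1)[of j n] that by (cases "j = n") auto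
  qed
  have "cmod (alternating_functional \<mu> n (monom 1 k)) \<le> 1" for k
  proof -
    have eq: "alternating_functional \<mu> n (monom 1 k) = complex_of_real (\<mu> 0 ^ k) +
        (\<Sum>j<n. (- 1) ^ Suc j * complex_of_real (\<mu> (Suc j) ^ k - \<mu> j ^ k))"
      by (simp add: alternating_functional_def poly_monom)
    have "cmod (alternating_functional \<mu> n (monom 1 k))
        \<le> cmod (complex_of_real (\<mu> 0 ^ k)) +
          (\<Sum>j<n. cmod ((- 1) ^ Suc j * complex_of_real (\<mu> (Suc j) ^ k - \<mu> j ^ k)))"
      unfolding eq by (intro order_trans[OF norm_triangle_ineq] add_left_mono norm_sum)
    also have "(\<Sum>j<n. cmod ((- 1) ^ Suc j * complex_of_real (\<mu> (Suc j) ^ k - \<mu> j ^ k)))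
        = (\<Sum>j<n. \<mu> (Suc j) ^ k - \<mu> j ^ k)"
    proof (rule sum.cong)
      fix j assume "j \<in> {..<n}"
      then have "\<mu> j ^ k \<le> \<mu> (Suc j) ^ k"
        using \<mu>(1)[of j "Suc j"] nn(1)[of j] by (intro power_mono) auto
      then show "cmod ((- 1) ^ Suc j * complex_of_real (\<mu> (Suc j) ^ k - \<mu> j ^ k)) = \<mu> (Suc j) ^ k - \<mu> j ^ k"
        unfolding norm_mult norm_of_real by (simp add: norm_power)
    qed simp
    also have "\<dots> = \<mu> n ^ k - \<mu> 0 ^ k"
      by (rule sum_lessThan_telescope)
    also have "cmod (complex_of_real (\<mu> 0 ^ k)) = \<mu> 0 ^ k"
      using \<mu>(2) by (simp add: norm_power)
    also have "\<mu> 0 ^ k + (\<mu> n ^ k - \<mu> 0 ^ k) \<le> 1"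
      using nn(1)[of n] \<mu>(3) by (simp add: power_le_one)
    finally show ?thesis .
  qed
  moreover have "poly (node_poly \<mu> (Suc n)) (\<mu> j) = 0" if "j \<le> n" for j
    using that by (intro node_poly_root) simp
  ultimately show ?thesis
    by (auto simp: power_bounded_functional_def alternating_functional_def sum.distrib
        algebra_simps sum_distrib_left sum_subtractf sum_negf)
qed

text \<open>At the exact values \<open>(- 1) ^ j\<close> every difference contributes 2 and the
  first term 1. The deviations cost at most \<open>e\<close> in the first term and
  \<open>2 * e\<close> in each difference.\<close>

lemma alternating_functional_near:
  assumes "\<And>j. j \<le> n \<Longrightarrow> cmod (poly p (\<mu> j) - (- 1) ^ j) \<le> e"
  shows "(2 * real n + 1) * (1 - e) \<le> cmod (alternating_functional \<mu> n p)"
proof -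
  define D where "D = (poly p (\<mu> 0) - 1) + (\<Sum>j<n. (- 1) ^ Suc j *
      ((poly p (\<mu> (Suc j)) - (- 1) ^ Suc j) - (poly p (\<mu> j) - (- 1) ^ j)))"
  have two: "(- 1) ^ Suc j * ((- 1) ^ Suc j - (- 1) ^ j) = (2 :: complex)" for j
    by (cases "even j") simp_all
  have "alternating_functional \<mu> n p - D
      = 1 + (\<Sum>j<n. (- 1) ^ Suc j * ((- 1) ^ Suc j - (- 1) ^ j))"
    unfolding D_def alternating_functional_def by (simp add: algebra_simps sum.distrib sum_subtractf sum_negf)
  also have "\<dots> = of_real (2 * real n + 1)"
    by (simp only: two) simp
  finally have *: "alternating_functional \<mu> n p = of_real (2 * real n + 1) + D"
    by (simp add: algebra_simps)
  have "cmod D \<le> cmod (poly p (\<mu> 0) - 1) + (\<Sum>j<n. cmod ((- 1) ^ Suc j *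
      ((poly p (\<mu> (Suc j)) - (- 1) ^ Suc j) - (poly p (\<mu> j) - (- 1) ^ j))))"
    unfolding D_def by (intro order_trans[OF norm_triangle_ineq] add_left_mono norm_sum)
  also have "\<dots> \<le> e + (\<Sum>j<n. 2 * e)"
  proof (intro add_mono sum_mono)
    show "cmod (poly p (\<mu> 0) - 1) \<le> e" using assms[of 0] by simp
    fix j assume "j \<in> {..<n}"
    then show "cmod ((- 1) ^ Suc j * ((poly p (\<mu> (Suc j)) - (- 1) ^ Suc j) - (poly p (\<mu> j) - (- 1) ^ j))) \<le> 2 * e"
      using assms[of j] assms[of "Suc j"]
        norm_triangle_ineq4[of "poly p (\<mu> (Suc j)) - (- 1) ^ Suc j" "poly p (\<mu> j) - (- 1) ^ j"]
      unfolding norm_mult by (simp add: norm_power del: power_Suc)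
  qed
  finally have "cmod D \<le> (2 * real n + 1) * e" by (simp add: algebra_simps)
  moreover have "cmod (alternating_functional \<mu> n p - D) = 2 * real n + 1"
    unfolding * add_diff_cancel_right' norm_of_real by simp
  then have "2 * real n + 1 \<le> cmod (alternating_functional \<mu> n p) + cmod D"
    using norm_triangle_ineq4[of "alternating_functional \<mu> n p" D] by simp
  ultimately show ?thesis by (simp add: algebra_simps)
qed

text \<open>Taylor polynomials converge uniformly only on smaller discs; the dilation by
  \<open>r\<close> makes such a disc the image of the closed unit disc.\<close>

lemma holomorphic_disc_poly_approx:
  fixes r e :: real
  assumes f: "f holomorphic_on ball 0 1" and r: "0 < r" "r < 1" and e: "e > 0"
  obtains p where "\<And>z::complex. cmod z \<le> 1 \<Longrightarrow> cmod (poly p z - f (r * z)) < e"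
proof -
  define c where "c = fps_nth (fps_expansion f 0)"
  have hol: "f holomorphic_on eball 0 (ereal 1)" using f by simp
  have "conv_radius c \<ge> 1"
    using conv_radius_fps_expansion[OF hol] by (simp add: c_def fps_conv_radius_def one_ereal_def)
  moreover have "ereal r < 1" using r by (simp add: one_ereal_def)
  ultimately have "ereal r < conv_radius c" by (rule less_le_trans[rotated])
  from powser_uniform_limit[OF this, of 0]
  have "\<forall>\<^sub>F N in sequentially. \<forall>w\<in>cball 0 r. dist (\<Sum>i<N. c i * (w - 0) ^ i) (\<Sum>i. c i * (w - 0) ^ i) < e"
    using e by (simp add: uniform_limit_iff)
  then obtain N where "\<forall>n\<ge>N. \<forall>w\<in>cball 0 r.
      dist (\<Sum>i<n. c i * (w - 0) ^ i) (\<Sum>i. c i * (w - 0) ^ i) < e"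
    unfolding eventually_sequentially by blast
  then have N: "dist (\<Sum>i<N. c i * (w - 0) ^ i) (\<Sum>i. c i * (w - 0) ^ i) < e"
    if "w \<in> cball 0 r" for w
    using that by blast
  define p where "p = (\<Sum>i<N. monom (c i * of_real r ^ i) i)"
  have "cmod (poly p z - f (r * z)) < e" if z: "cmod z \<le> 1" for z :: complex
  proof -
    have w: "cmod (r * z) \<le> r" using z r by (simp add: norm_mult)
    have "(\<Sum>i. c i * (r * z) ^ i) = f (r * z)"
      using eval_fps_expansion'[OF hol, of "r * z"] w r by (simp add: eval_fps_def c_def)
    moreover have "poly p z = (\<Sum>i<N. c i * (r * z) ^ i)"
      by (simp add: p_def poly_sum poly_monom power_mult_distrib mult.assoc)
    ultimately show ?thesis
      using N[of "r * z"] w by (simp add: dist_norm)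
  qed
  then show ?thesis by (rule that)
qed

text \<open>The function \<open>(1 - z) powr (i \<theta>)\<close> is nearly unimodular on the disc for small \<open>\<theta>\<close>, but it
  winds around the unit circle infinitely often as \<open>z\<close> increases to 1.\<close>

lemma alternating_poly_exists:
  assumes e: "0 < e" "e < 1"
  obtains p :: "complex poly" and \<mu> :: "nat \<Rightarrow> real"
  where "\<And>z::complex. cmod z \<le> 1 \<Longrightarrow> cmod (poly p z) \<le> 1"
    and "\<And>i j. i < j \<Longrightarrow> \<mu> i < \<mu> j" "\<mu> 0 = 0" "\<mu> n \<le> 1"
    and "\<And>j. j \<le> n \<Longrightarrow> cmod (poly p (\<mu> j) - (- 1) ^ j) \<le> e"
proof -
  \<comment> \<open>The errors below add up to at most \<open>3 * \<delta>\<close>.\<close>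
  define \<delta> where "\<delta> = e / 4"
  have \<delta>: "\<delta> > 0" "\<delta> < 1" using e by (simp_all add: \<delta>_def)
  define s where "s = 1 - \<delta>"
  have s: "0 < s" "s < 1" using \<delta> by (simp_all add: s_def)
  \<comment> \<open>Chosen so that \<open>exp (\<theta> * pi / 2) = 1 / s\<close>: in the right
    half-plane the argument is below \<open>pi / 2\<close>, so the factor \<open>s\<close> in
    \<open>f\<close> brings the modulus down to at most 1.\<close>
  define \<theta> where "\<theta> = - 2 * ln s / pi"
  have \<theta>: "\<theta> > 0" using s ln_less_zero[of s] by (simp add: \<theta>_def divide_neg_pos)
  define f where "f = (\<lambda>z. complex_of_real s * exp (\<i> * complex_of_real \<theta> * Ln (1 - z)))"
  have re: "Re (1 - z) > 0" if "cmod z < 1" for z :: complex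
    using that complex_Re_le_cmod[of z] by simp
  have hol: "f holomorphic_on ball 0 1"
  proof -
    have "1 - z \<notin> \<real>\<^sub>\<le>\<^sub>0" if "z \<in> ball 0 1" for z :: complex
      using re[of z] that by (auto simp: complex_nonpos_Reals_iff)
    then show ?thesis unfolding f_def by (intro holomorphic_intros) auto
  qed
  have f1: "cmod (f z) \<le> 1" if "cmod z < 1" for z :: complex
  proof -
    have "1 - z \<noteq> 0" using re[OF that] by auto
    then have "\<bar>Im (Ln (1 - z))\<bar> < pi / 2"
      using Re_Ln_pos_lt[of "1 - z"] re[OF that] by blast
    then have "- Im (Ln (1 - z)) \<le> pi / 2" by linarith
    then have "- \<theta> * Im (Ln (1 - z)) \<le> \<theta> * (pi / 2)"
      using \<theta> mult_left_mono[of "- Im (Ln (1 - z))" "pi / 2" \<theta>] by simp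
    also have "\<dots> = - ln s" using pi_gt_zero by (simp add: \<theta>_def)
    finally have "exp (- \<theta> * Im (Ln (1 - z))) \<le> exp (- ln s)" by simp
    also have "\<dots> = 1 / s" using s by (simp add: exp_minus divide_inverse)
    finally have "s * exp (- \<theta> * Im (Ln (1 - z))) \<le> 1"
      using s by (simp add: field_simps)
    then show ?thesis using s by (simp add: f_def norm_mult)
  qed
  \<comment> \<open>Here \<open>ln (1 - x j) = - pi j / \<theta>\<close>, so \<open>f\<close> takes
    the value \<open>s * (- 1) ^ j\<close>.\<close>
  define x where "x = (\<lambda>j::nat. 1 - exp (- pi * real j / \<theta>))"
  have x_mono: "x i < x j" if "i < j" for i j
    using that \<theta> by (simp add: x_def divide_strict_right_mono)
  have x0: "x 0 = 0" and x1: "x j < 1" for j by (simp_all add: x_def)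
  have xn: "0 \<le> x j" for j using \<theta> by (simp add: x_def)
  have fx: "f (x j) = s * (- 1) ^ j" for j
  proof -
    have "1 - complex_of_real (x j) = complex_of_real (exp (- pi * real j / \<theta>))"
      by (simp add: x_def)
    also have "Ln \<dots> = complex_of_real (- pi * real j / \<theta>)"
      by (subst Ln_of_real) simp_all
    finally have "\<i> * complex_of_real \<theta> * Ln (1 - x j) = - (of_nat j * (complex_of_real pi * \<i>))"
      using \<theta> by simp
    then show ?thesis
      by (cases "even j") (simp_all add: f_def exp_minus exp_of_nat_mult)
  qed
  \<comment> \<open>Any number between \<open>x n\<close> and 1 would do: the rescaled nodes
    \<open>x j / r\<close> stay in the unit interval, and \<open>f (r z)\<close> at them is
    \<open>f (x j)\<close>.\<close>
  define r where "r = (1 + x n) / 2"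
  have r: "0 < r" "r < 1" "x n \<le> r"
    using x1[of n] xn[of n] by (simp_all add: r_def)
  obtain q where q: "\<And>z::complex. cmod z \<le> 1 \<Longrightarrow> cmod (poly q z - f (r * z)) < \<delta>"
    using holomorphic_disc_poly_approx[OF hol r(1,2) \<delta>(1)] by blast
  \<comment> \<open>The approximant is bounded by \<open>1 + \<delta>\<close> on the disc, and
    \<open>s (1 + \<delta>) = 1 - \<delta>^2\<close>.\<close>
  define p where "p = Polynomial.smult (complex_of_real s) q"
  define \<mu> where "\<mu> = (\<lambda>j. x j / r)"
  show ?thesis
  proof (rule that[of p \<mu>])
    show "cmod (poly p z) \<le> 1" if z: "cmod z \<le> 1" for z :: complex
    proof -
      have "cmod (r * z) < 1"
        using z r by (simp add: norm_mult) (smt (verit) mult_left_le)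
      then have "cmod (poly q z) \<le> 1 + \<delta>"
        using q[OF z] f1 norm_triangle_ineq2[of "poly q z" "f (r * z)"] by fastforce
      then have "s * cmod (poly q z) \<le> s * (1 + \<delta>)"
        using s by simp
      also have "\<dots> \<le> 1" by (simp add: s_def algebra_simps)
      finally show ?thesis using s by (simp add: p_def norm_mult)
    qed
    show "\<mu> i < \<mu> j" if "i < j" for i j
      using x_mono[OF that] r by (simp add: \<mu>_def divide_strict_right_mono)
    show "\<mu> 0 = 0" "\<mu> n \<le> 1" using x0 r by (simp_all add: \<mu>_def)
    show "cmod (poly p (\<mu> j) - (- 1) ^ j) \<le> e" if j: "j \<le> n" for j
    proof -
      have "x j \<le> x n" using x_mono[of j n] j by (cases "j = n") auto
      then have "cmod (complex_of_real (\<mu> j)) \<le> 1"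
        using r xn[of j] by (simp add: \<mu>_def norm_divide)
      moreover have "complex_of_real r * complex_of_real (\<mu> j) = complex_of_real (x j)"
        using r by (simp add: \<mu>_def)
      ultimately have *: "cmod (poly q (\<mu> j) - s * (- 1) ^ j) < \<delta>"
        using q[of "\<mu> j"] by (simp add: fx)
      have "poly p (\<mu> j) - (- 1) ^ j
          = s * (poly q (\<mu> j) - s * (- 1) ^ j) + of_real (s * s - 1) * (- 1) ^ j"
        by (simp add: p_def algebra_simps)
      then have "cmod (poly p (\<mu> j) - (- 1) ^ j)
          \<le> s * cmod (poly q (\<mu> j) - s * (- 1) ^ j) + \<bar>s * s - 1\<bar>"
        using norm_triangle_ineq[of "s * (poly q (\<mu> j) - s * (- 1) ^ j)" "of_real (s * s - 1) * (- 1) ^ j"] s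
        by (simp only: norm_mult norm_of_real norm_power norm_minus_cancel norm_one power_one) simp
      also have "\<dots> \<le> 1 * \<delta> + 2 * \<delta>"
      proof (intro add_mono mult_mono)
        have "s * s \<le> 1" using s by (simp add: mult_le_one)
        then show "\<bar>s * s - 1\<bar> \<le> 2 * \<delta>" by (simp add: s_def algebra_simps)
      qed (use * s in auto)
      finally show ?thesis using e by (simp add: \<delta>_def)
    qed
  qed
qed

section \<open>The universal constants\<close>

lemma Gamma_in_upper:
  fixes A :: "'u normed_alg"
  assumes "unital_banach_algebra A" "a \<in> carrier A" "algebraic_degree_le A a n"
  shows "spectral_constant A a \<le> Gamma_in TYPE('u) n"
  unfolding Gamma_in_def by (rule SUP_upper2[of "(A, a)"]) (use assms in auto)

lemma Gamma_in_least:
  assumes "\<And>(A :: 'u normed_alg) a. unital_banach_algebra A \<Longrightarrow> a \<in> carrier A \<Longrightarrow>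
    algebraic_degree_le A a n \<Longrightarrow> spectral_constant A a \<le> C"
  shows "Gamma_in TYPE('u) n \<le> C"
  unfolding Gamma_in_def by (rule SUP_least) (use assms in auto)

lemma algebraic_poly_eval_bound:
  assumes "unital_normed_algebra A" "a \<in> carrier A" "algebraic_degree_le A a n"
  shows "anorm A (poly_eval A p a) \<le> calculus_const n * range_sup A a p"
proof -
  interpret unital_normed_algebra A by (rule assms)
  obtain m where m: "lead_coeff m = 1" "degree m \<le> n" "\<And>p. poly_eval A p a = \<zero>\<^bsub>A\<^esub> \<longleftrightarrow> m dvd p"
    using algebraic_degree_leD[OF assms(2,3)] by blast
  have "m \<noteq> 0" using m(1) by auto
  moreover have "poly_eval A m a = \<zero>\<^bsub>A\<^esub>" using m(3)[of m] by simp
  ultimately show ?thesis by (rule poly_eval_bound[OF assms(2) _ m(2)])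
qed

lemma Gamma_in_le: "Gamma_in TYPE('u) n \<le> ereal (calculus_const n)"
proof (rule Gamma_in_least)
  fix A :: "'u normed_alg" and a
  assume A: "unital_banach_algebra A" "a \<in> carrier A" "algebraic_degree_le A a n"
  then interpret unital_banach_algebra A by simp
  show "spectral_constant A a \<le> ereal (calculus_const n)"
    using A algebraic_poly_eval_bound[OF unital_normed_algebra_axioms A(2,3)]
    by (intro spectral_constant_le) auto
qed

lemma Gamma_in_1_le: "Gamma_in TYPE('u) 1 \<le> 1"
proof (rule Gamma_in_least)
  fix A :: "'u normed_alg" and a
  assume A: "unital_banach_algebra A" "a \<in> carrier A" "algebraic_degree_le A a 1"
  then interpret unital_banach_algebra A by simp
  obtain m where m: "lead_coeff m = 1" "degree m \<le> 1" "\<And>p. poly_eval A p a = \<zero>\<^bsub>A\<^esub> \<longleftrightarrow> m dvd p"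
    using algebraic_degree_leD[OF A(2,3)] by blast
  have "m \<noteq> 0" using m(1) by auto
  moreover have "poly_eval A m a = \<zero>\<^bsub>A\<^esub>" using m(3)[of m] by simp
  ultimately have "anorm A (poly_eval A p a) \<le> 1 * range_sup A a p" for p
    using scalar_poly_eval_bound[OF A(2) _ m(2), of p] by simp
  from spectral_constant_le[OF A(2) this] show "spectral_constant A a \<le> 1"
    by (simp add: one_ereal_def)
qed

lemma Gamma_const_lower:
  assumes "n \<ge> 1"
  shows "ereal (2 * real n - 1) \<le> Gamma_const n"
proof -
  \<comment> \<open>The nodes are numbered from 0 to \<open>k\<close>, so
    \<open>2 n - 1 = 2 k + 1\<close>.\<close>
  obtain k where k: "n = Suc k" using assms by (cases n) auto
  have "ereal ((2 * real k + 1) * (1 - e)) \<le> Gamma_const n" if e: "0 < e" "e < 1" for e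
  proof -
    obtain p :: "complex poly" and \<mu> :: "nat \<Rightarrow> real"
      where p: "\<And>z::complex. cmod z \<le> 1 \<Longrightarrow> cmod (poly p z) \<le> 1"
        and \<mu>: "\<And>i j. i < j \<Longrightarrow> \<mu> i < \<mu> j" "\<mu> 0 = 0" "\<mu> k \<le> 1"
        and near: "\<And>j. j \<le> k \<Longrightarrow> cmod (poly p (\<mu> j) - (- 1) ^ j) \<le> e"
      using alternating_poly_exists[OF e, of k] by blast
    define m where "m = node_poly \<mu> n"
    have "poly_algebra_norm (power_bounded_norm m) m"
      unfolding m_def
    proof (rule poly_algebra_norm_node[OF assms])
      show "inj_on \<mu> {..<n}"
        using \<mu>(1) by (intro linorder_inj_onI) (auto simp: less_imp_neq)
      show "0 \<le> \<mu> j \<and> \<mu> j \<le> 1" if "j < n" for j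
        using \<mu>(1)[of 0 j] \<mu>(1)[of j k] \<mu>(2,3) that k by (cases "j = 0"; cases "j = k") auto
    qed
    then interpret Q: poly_algebra_norm "power_bounded_norm m" m .
    define x where "x = Q.enc [:0, 1:]"
    have x: "x \<in> carrier Q.quot_alg" by (simp add: x_def)
    have "anorm Q.quot_alg x = power_bounded_norm m (monom 1 1)"
      by (simp add: x_def Q.quot_alg_simps monom_Suc monom_0)
    then have "cmod z \<le> 1" if "z \<in> numerical_range Q.quot_alg x" for z
      using Q.quot.numerical_range_norm_le[OF x that] power_bounded_norm_X[of m 1] by simp
    then have le1: "range_sup Q.quot_alg x p \<le> 1"
      unfolding range_sup_def using p by (intro cSUP_least Q.quot.numerical_range_nonempty) auto
    have "power_bounded_functional m (alternating_functional \<mu> k)"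
      unfolding m_def k using \<mu> by (intro power_bounded_alternating) auto
    from power_bounded_norm_upper[OF this, of p] alternating_functional_near[where n = k, OF near]
    have ge: "(2 * real k + 1) * (1 - e) \<le> power_bounded_norm m p" by linarith
    have eval: "anorm Q.quot_alg (poly_eval Q.quot_alg p x) = power_bounded_norm m p"
      by (simp add: x_def Q.poly_eval_quot Q.quot_alg_simps)
    have alg: "algebraic_degree_le Q.quot_alg x n"
      unfolding x_def by (rule Q.algebraic_quot) (simp add: m_def degree_node_poly)
    \<comment> \<open>The polynomial counts in the spectral constant only if its supremum on the
      numerical range is positive; the upper bound yields this, since \<open>p(a)\<close> is
      nonzero.\<close>
    have "0 < (2 * real k + 1) * (1 - e)" using e by (intro mult_pos_pos) auto
    then have "0 < calculus_const n * range_sup Q.quot_alg x p"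
      using algebraic_poly_eval_bound[OF Q.quot.unital_normed_algebra_axioms x alg, of p] ge eval
      by linarith
    then have pos: "0 < range_sup Q.quot_alg x p"
      using calculus_const_nonneg[of n] by (simp add: zero_less_mult_iff)
    have "power_bounded_norm m p * range_sup Q.quot_alg x p \<le> power_bounded_norm m p"
      using le1 by (intro mult_left_le power_bounded_norm_nonneg)
    then have "power_bounded_norm m p \<le> power_bounded_norm m p / range_sup Q.quot_alg x p"
      using pos by (simp add: pos_le_divide_eq)
    then have "ereal ((2 * real k + 1) * (1 - e))
        \<le> ereal (anorm Q.quot_alg (poly_eval Q.quot_alg p x) / range_sup Q.quot_alg x p)"
      using ge by (simp add: eval)
    also have "\<dots> \<le> spectral_constant Q.quot_alg x"
      unfolding spectral_constant_def using pos by (intro SUP_upper) simp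
    also have "\<dots> \<le> Gamma_const n"
      unfolding Gamma_const_def by (rule Gamma_in_upper[OF Q.unital_banach_algebra_quot x alg])
    finally show ?thesis .
  qed
  note near = this
  show ?thesis
  \<comment> \<open>The limit \<open>e \<rightarrow> 0\<close>, with the factor \<open>r\<close>
    below in the role of \<open>1 - e\<close>.\<close>
  proof (rule ereal_le_mult_one_interval)
    show "Gamma_const n \<noteq> - \<infinity>"
      using near[of "1 / 2"] by auto
    fix z :: ereal assume z: "0 < z" "z < 1"
    then obtain r where r: "z = ereal r" by (cases z) auto
    then have "0 < r" "r < 1" using z by (simp_all add: one_ereal_def)
    then have "ereal ((2 * real k + 1) * (1 - (1 - r))) \<le> Gamma_const n"
      by (intro near) auto
    then show "z * ereal (2 * real n - 1) \<le> Gamma_const n"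
      by (simp add: r k mult.commute algebra_simps)
  qed
qed

lemma Gamma_const_1: "Gamma_const 1 = 1"
  using Gamma_const_lower[of 1] Gamma_in_1_le[where 'u = "nat \<Rightarrow> complex"]
  by (intro order_antisym) (simp_all add: Gamma_const_def one_ereal_def)

lemma Gamma_const_real:
  assumes "n \<ge> 1"
  obtains C where "C \<ge> 1" "Gamma_const n = ereal C"
proof (cases "Gamma_const n")
  case (real C)
  have "ereal 1 \<le> ereal (2 * real n - 1)" using assms by simp
  then show ?thesis
    using real Gamma_const_lower[OF assms] that by (metis ereal_less_eq(3) order_trans)
next
  case PInf
  then show ?thesis
    using Gamma_in_le[of n, where 'u = "nat \<Rightarrow> complex"] by (simp add: Gamma_const_def)
next
  case MInf
  then show ?thesis using Gamma_const_lower[OF assms] by simp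
qed

text \<open>Whatever the type of \<open>A\<close>, the quotient by the minimal polynomial of
  \<open>a\<close> is a Banach algebra on \<open>nat \<Rightarrow> complex\<close>, so it competes
  in the supremum \<open>Gamma_const n\<close>.\<close>

lemma spectral_constant_le_Gamma_const:
  assumes n: "n \<ge> 1" and A: "unital_normed_algebra A" "a \<in> carrier A" "algebraic_degree_le A a n"
  shows "spectral_constant A a \<le> Gamma_const n"
proof -
  interpret unital_normed_algebra A by (rule A)
  obtain m where m: "lead_coeff m = 1" "degree m \<le> n" "\<And>p. poly_eval A p a = \<zero>\<^bsub>A\<^esub> \<longleftrightarrow> m dvd p"
    using algebraic_degree_leD[OF A(2,3)] by blast
  have m0: "m \<noteq> 0" using m(1) by auto
  interpret Q: poly_algebra_norm "\<lambda>p. anorm A (poly_eval A p a)" m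
    by (rule poly_algebra_norm_eval[OF A(2) m0 m(3)])
  have "spectral_constant Q.quot_alg (Q.enc [:0, 1:]) \<le> Gamma_const n"
    unfolding Gamma_const_def
    by (rule Gamma_in_upper[OF Q.unital_banach_algebra_quot Q.enc_closed Q.algebraic_quot[OF m(2)]])
  moreover have "0 \<le> Gamma_const n"
    using Gamma_const_real[OF n] by (metis ereal_less_eq(5) order_trans zero_le_one)
  ultimately show ?thesis
    by (intro spectral_constant_quot_le[OF A(2) m0 m(3)])
qed

lemma Gamma_const_bound:
  assumes n: "n \<ge> 1" and C: "Gamma_const n = ereal C"
    and A: "unital_normed_algebra A" "a \<in> carrier A" "algebraic_degree_le A a n"
  shows "anorm A (poly_eval A p a) \<le> C * range_sup A a p"
proof -
  interpret unital_normed_algebra A by (rule A)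
  show ?thesis
  proof (cases "range_sup A a p > 0")
    case True
    then have "ereal (anorm A (poly_eval A p a) / range_sup A a p) \<le> spectral_constant A a"
      unfolding spectral_constant_def by (intro SUP_upper) simp
    also have "\<dots> \<le> ereal C"
      using spectral_constant_le_Gamma_const[OF n A] C by simp
    finally show ?thesis using True by (simp add: pos_divide_le_eq)
  \<comment> \<open>A polynomial with supremum 0 does not occur in the spectral constant; that
    \<open>p(a)\<close> vanishes follows from the bound with \<open>calculus_const\<close>.\<close>
  next
    case False
    then have "range_sup A a p = 0" using range_sup_nonneg[OF A(2), of p] by simp
    then show ?thesis using algebraic_poly_eval_bound[OF A, of p] by simp
  qed
qed

lemma matrix_poly_eval_bound:
  assumes "unital_normed_algebra (matrix_alg d N)" "a \<in> carrier_mat d d"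
  shows "N (poly_eval (matrix_alg d N) p a)
    \<le> calculus_const (2 ^ (d * d)) * range_sup (matrix_alg d N) a p"
proof -
  interpret unital_normed_algebra "matrix_alg d N" by (rule assms)
  obtain m where "m \<noteq> 0" "degree m \<le> 2 ^ (d * d)"
      "poly_eval (matrix_alg d N) m a = \<zero>\<^bsub>matrix_alg d N\<^esub>"
    using matrix_annihilating_poly[OF assms] by blast
  moreover have "a \<in> carrier (matrix_alg d N)" using assms(2) by (simp add: matrix_alg_def)
  ultimately have "anorm (matrix_alg d N) (poly_eval (matrix_alg d N) p a)
      \<le> calculus_const (2 ^ (d * d)) * range_sup (matrix_alg d N) a p"
    using poly_eval_bound by blast
  then show ?thesis by (simp add: matrix_alg_def)
qed

theorem theoremA:
  shows "Gamma_const 1 = 1 \<and>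
    (\<forall>n\<ge>2. ereal (2 * real n - 1) \<le> Gamma_const n \<and> Gamma_const n < \<infinity>) \<and>
    (\<forall>n\<ge>1. Gamma_in TYPE('a) n \<le> Gamma_const n) \<and>
    (\<forall>n\<ge>1. \<exists>C::real. ereal C = Gamma_const n \<and>
      (\<forall>(A :: 'a normed_alg) a p.
        unital_banach_algebra A \<longrightarrow> a \<in> carrier A \<longrightarrow> algebraic_degree_le A a n \<longrightarrow>
        anorm A (poly_eval A p a) \<le> C * range_sup A a p)) \<and>
    (\<forall>d\<ge>1. \<exists>C::real. \<forall>N a p.
      unital_normed_algebra (matrix_alg d N) \<longrightarrow> a \<in> carrier_mat d d \<longrightarrow>
      N (poly_eval (matrix_alg d N) p a) \<le> C * range_sup (matrix_alg d N) a p)"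
proof (intro conjI allI impI)
  show "Gamma_const 1 = 1" by (rule Gamma_const_1)
  show "ereal (2 * real n - 1) \<le> Gamma_const n" if "n \<ge> 2" for n
    using that by (intro Gamma_const_lower) simp
  show "Gamma_const n < \<infinity>" if "n \<ge> 2" for n
    using Gamma_in_le[of n, where 'u = "nat \<Rightarrow> complex"] by (auto simp: Gamma_const_def)
  show "Gamma_in TYPE('a) n \<le> Gamma_const n" if "n \<ge> 1" for n
    using that by (intro Gamma_in_least spectral_constant_le_Gamma_const unital_banach_algebra.axioms(1))
  show "\<exists>C::real. ereal C = Gamma_const n \<and> (\<forall>(A :: 'a normed_alg) a p.
      unital_banach_algebra A \<longrightarrow> a \<in> carrier A \<longrightarrow> algebraic_degree_le A a n \<longrightarrow>
      anorm A (poly_eval A p a) \<le> C * range_sup A a p)" if n: "n \<ge> 1" for n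
  proof -
    obtain C where C: "Gamma_const n = ereal C" using Gamma_const_real[OF n] by blast
    show ?thesis
      by (intro exI[of _ C] conjI allI impI Gamma_const_bound[OF n C] unital_banach_algebra.axioms(1))
        (simp_all add: C)
  qed
  show "\<exists>C::real. \<forall>N a p. unital_normed_algebra (matrix_alg d N) \<longrightarrow> a \<in> carrier_mat d d \<longrightarrow>
      N (poly_eval (matrix_alg d N) p a) \<le> C * range_sup (matrix_alg d N) a p" for d
    using matrix_poly_eval_bound by blast
qed

end
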